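(* Let $\mathbf{k}$ be a field and let $B$ be the commutative polynomial algebra in $|\mathbb{N}|$ (countably infinitely many) variables over $\mathbf{k}$. Then for each integer $m\ge2$ there exists a Lie subalgebra $L$ of $\mathrm{Der}_{\mathbf{k}}(B)$, generated as a Lie algebra by $m$ elements, satisfying: (a) $L$ is not a locally nilpotent subset of $\mathrm{Der}_{\mathbf{k}}(B)$; (b) every Lie subalgebra of $L$ generated by $m-1$ elements is a locally nilpotent subset of $\mathrm{Der}_{\mathbf{k}}(B)$ and a nilpotent Lie algebra; (c) every element of $L$ is a locally nilpotent derivation of $B$, and $L$ is a nil Lie algebra.
   Context: $\mathrm{Der}_{\mathbf{k}}(B)$ is the Lie algebra over $\mathbf{k}$ of all $\mathbf{k}$-derivations $B\to B$, with bracket $[D,E]=D\circ E-E\circ D$. A subset $\Delta$ of $\mathrm{Der}_{\mathbf{k}}(B)$ is locally nilpotent if for every $x\in B$ and every infinite sequence $(F_0,F_1,\dots)$ of elements of $\Delta$ there exists $n\in\mathbb{N}$ with $(F_n\circ\cdots\circ F_0)(x)=0$. A derivation $D$ is locally nilpotent if for each $x\in B$ there is $n>0$ with $D^n(x)=0$. A Lie algebra $A$ is nilpotent if there exists $n\ge1$ such that $[x_n,[x_{n-1},\dots,[x_2,x_1]\dots]]=0$ for all $(x_1,\dots,x_n)\in A^n$. A Lie algebra $A$ is nil if for each $x\in A$ the linear map $\mathrm{ad}(x):A\to A$, $y\mapsto[x,y]$, is nilpotent. *)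

theory Defs
  imports Complex_Main "HOL-Library.Poly_Mapping" "HOL-Library.Function_Algebras"
begin

section \<open>The polynomial algebra in countably many variables\<close>

text \<open>
  A monomial is a finitely supported exponent vector on the set of variables, which is indexed
  by \<open>nat\<close>; a polynomial is a finitely supported family of coefficients on the monomials. The
  product of \<open>poly_mapping\<close> is convolution, that is, multiplication of polynomials.
\<close>

type_synonym 'k poly_inf = "(nat \<Rightarrow>\<^sub>0 nat) \<Rightarrow>\<^sub>0 'k"

definition poly_scale :: "'k::field \<Rightarrow> 'k poly_inf \<Rightarrow> 'k poly_inf" where
  "poly_scale c p = Poly_Mapping.single 0 c * p"

lemma vector_space_poly_scale: "vector_space poly_scale"
  by unfold_locales
    (simp_all add: poly_scale_def algebra_simps single_add mult_single flip: mult.assoc)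


section \<open>Derivations\<close>

definition Der :: "('k::field poly_inf \<Rightarrow> 'k poly_inf) set" where
  "Der = {D. Vector_Spaces.linear poly_scale poly_scale D \<and>
             (\<forall>p q. D (p * q) = D p * q + p * D q)}"

definition locally_nilpotent_derivation :: "('k::field poly_inf \<Rightarrow> 'k poly_inf) \<Rightarrow> bool" where
  "locally_nilpotent_derivation D \<longleftrightarrow> D \<in> Der \<and> (\<forall>p. \<exists>n>0. (D ^^ n) p = 0)"

text \<open>\<open>comp_seq F n\<close> is the composite of \<open>F n, \<dots>, F 0\<close>, with \<open>F 0\<close> applied first.\<close>

primrec comp_seq :: "(nat \<Rightarrow> 'a \<Rightarrow> 'a) \<Rightarrow> nat \<Rightarrow> 'a \<Rightarrow> 'a" where
  "comp_seq F 0 = F 0"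
| "comp_seq F (Suc n) = F (Suc n) \<circ> comp_seq F n"

definition locally_nilpotent_set :: "('k::field poly_inf \<Rightarrow> 'k poly_inf) set \<Rightarrow> bool" where
  "locally_nilpotent_set \<Delta> \<longleftrightarrow>
     (\<forall>p. \<forall>F :: nat \<Rightarrow> 'k poly_inf \<Rightarrow> 'k poly_inf.
        (\<forall>i. F i \<in> \<Delta>) \<longrightarrow> (\<exists>n. comp_seq F n p = 0))"


section \<open>Lie algebras of derivations\<close>

text \<open>Addition and zero of functions are pointwise (from \<open>Function_Algebras\<close>).\<close>

definition der_scale ::
    "'k::field \<Rightarrow> ('k poly_inf \<Rightarrow> 'k poly_inf) \<Rightarrow> ('k poly_inf \<Rightarrow> 'k poly_inf)" where
  "der_scale c D = (\<lambda>p. poly_scale c (D p))"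

lemma vector_space_der_scale: "vector_space der_scale"
proof -
  interpret vector_space poly_scale by (rule vector_space_poly_scale)
  show ?thesis
    by unfold_locales
      (simp_all add: der_scale_def fun_eq_iff scale_right_distrib scale_left_distrib)
qed

definition lie_bracket :: "('b::ab_group_add \<Rightarrow> 'b) \<Rightarrow> ('b \<Rightarrow> 'b) \<Rightarrow> ('b \<Rightarrow> 'b)" where
  "lie_bracket D E = (D \<circ> E) - (E \<circ> D)"

definition lie_subalgebra :: "('k::field poly_inf \<Rightarrow> 'k poly_inf) set \<Rightarrow> bool" where
  "lie_subalgebra L \<longleftrightarrow> L \<subseteq> Der \<and> module.subspace der_scale L \<and>
     (\<forall>D\<in>L. \<forall>E\<in>L. lie_bracket D E \<in> L)"

text \<open>
  The hull is the intersection of all Lie subalgebras of \<^term>\<open>Der\<close> containing the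
  generators. The family of generators may have repetitions.
\<close>

definition lie_generated_by :: "('k::field poly_inf \<Rightarrow> 'k poly_inf) set \<Rightarrow> nat \<Rightarrow> bool" where
  "lie_generated_by L n \<longleftrightarrow>
     (\<exists>g :: nat \<Rightarrow> 'k poly_inf \<Rightarrow> 'k poly_inf.
        (\<forall>i<n. g i \<in> Der) \<and> L = lie_subalgebra hull (g ` {..<n}))"

text \<open>\<open>nested_bracket x n\<close> is \<open>[x n, [x (n - 1), \<dots> [x 1, x 0] \<dots>]]\<close>, with \<open>n + 1\<close> entries.\<close>

primrec nested_bracket :: "(nat \<Rightarrow> ('b::ab_group_add \<Rightarrow> 'b)) \<Rightarrow> nat \<Rightarrow> ('b \<Rightarrow> 'b)" where
  "nested_bracket x 0 = x 0"
| "nested_bracket x (Suc n) = lie_bracket (x (Suc n)) (nested_bracket x n)"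

definition nilpotent_lie :: "('b::ab_group_add \<Rightarrow> 'b) set \<Rightarrow> bool" where
  "nilpotent_lie A \<longleftrightarrow>
     (\<exists>n\<ge>1. \<forall>x. (\<forall>i<n. x i \<in> A) \<longrightarrow> nested_bracket x (n - 1) = 0)"

definition nil_lie :: "('b::ab_group_add \<Rightarrow> 'b) set \<Rightarrow> bool" where
  "nil_lie A \<longleftrightarrow> (\<forall>x\<in>A. \<exists>n. \<forall>y\<in>A. ((lie_bracket x) ^^ n) y = 0)"

lemma lie_bracket_in_Der:
  assumes "D \<in> Der" and "E \<in> Der"
  shows "lie_bracket D E \<in> Der"
proof -
  interpret vector_space_pair poly_scale poly_scale
    by (intro vector_space_pair.intro vector_space_poly_scale)
  from assms have D: "Vector_Spaces.linear poly_scale poly_scale D"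
      "\<And>p q. D (p * q) = D p * q + p * D q"
    and E: "Vector_Spaces.linear poly_scale poly_scale E"
      "\<And>p q. E (p * q) = E p * q + p * E q"
    by (auto simp: Der_def)
  have "Vector_Spaces.linear poly_scale poly_scale (\<lambda>p. (D \<circ> E) p - (E \<circ> D) p)"
    using D(1) E(1) by (intro linear_compose_sub Vector_Spaces.linear_compose)
  then have "Vector_Spaces.linear poly_scale poly_scale (lie_bracket D E)"
    by (simp add: lie_bracket_def fun_diff_def)
  moreover have "lie_bracket D E (p * q) = lie_bracket D E p * q + p * lie_bracket D E q" for p q
    by (simp add: lie_bracket_def D(2) E(2) linear_add[OF D(1)] linear_add[OF E(1)] algebra_simps)
  ultimately show ?thesis
    by (simp add: Der_def)
qed

lemma subspace_Der: "module.subspace der_scale Der"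
proof -
  interpret vector_space_pair poly_scale poly_scale
    by (intro vector_space_pair.intro vector_space_poly_scale)
  interpret d: vector_space der_scale by (rule vector_space_der_scale)
  show ?thesis
    unfolding d.subspace_def
  proof (intro conjI ballI allI)
    show "0 \<in> Der"
      using linear_zero by (simp add: Der_def zero_fun_def)
  next
    fix D E :: "'a poly_inf \<Rightarrow> 'a poly_inf"
    assume "D \<in> Der" and "E \<in> Der"
    then show "D + E \<in> Der"
      using linear_compose_add[of D E] by (auto simp: Der_def plus_fun_def algebra_simps)
  next
    fix c and D :: "'a poly_inf \<Rightarrow> 'a poly_inf"
    assume "D \<in> Der"
    then show "der_scale c D \<in> Der"
      using linear_compose_scale_right[of D c]
      by (auto simp: Der_def der_scale_def poly_scale_def algebra_simps)
  qed
qed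

lemma lie_subalgebra_Der: "lie_subalgebra Der"
  by (simp add: lie_subalgebra_def subspace_Der lie_bracket_in_Der)

lemma lie_subalgebra_hull:
  assumes "S \<subseteq> Der"
  shows "lie_subalgebra (lie_subalgebra hull S)"
proof -
  interpret d: vector_space der_scale by (rule vector_space_der_scale)
  have "lie_subalgebra hull S \<subseteq> Der"
    using assms lie_subalgebra_Der by (auto simp: hull_def)
  then show ?thesis
    unfolding lie_subalgebra_def hull_def d.subspace_def by auto
qed

end

theory Submission
  imports Defs "HOL-Library.Multiset" "HOL-Library.FuncSet" "HOL-Library.Nat_Bijection"
begin

text \<open>
  Golod's method. Let \<open>R\<close> be the free associative algebra on \<open>m\<close> letters. For each \<open>n\<close> choose a
  large \<open>N\<close> and impose, as relations, the coefficients (with respect to commuting indeterminates)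
  of all products of length \<open>N\<close> of \<open>m - 1\<close> generic elements supported on the words of length
  \<open>1, \<dots>, n\<close>. There are at most \<open>(m - 1)^N\<close> times a polynomial in \<open>N\<close> of them, all of degree at
  least \<open>N\<close>, so they are so sparse that, by the Golod-Shafarevich dimension count, the quotient
  \<open>A\<close> still grows like \<open>(m - 1/2)^n\<close>, while any \<open>m - 1\<close> elements of its augmentation ideal generate
  a nilpotent algebra. Left multiplication lets \<open>A\<close> act on a space of countable dimension, whose
  symmetric algebra is \<open>B\<close>; \<open>L\<close> is generated by the derivations that extend the action of the
  letters. Nilpotence of a set of operators on linear forms passes to \<open>B\<close> by the Leibniz rule.
\<close>

text \<open>Updating at a fresh key is adding a \<open>single\<close>, so
  \<open>update_induct\<close> turns into induction over sums of terms, the form in which additive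
  identities are checked below.\<close>

lemma poly_mapping_single_induct [case_names zero single add]:
  fixes p :: "'a \<Rightarrow>\<^sub>0 'b::comm_monoid_add"
  assumes "P 0" and "\<And>k c. P (Poly_Mapping.single k c)" and "\<And>p q. P p \<Longrightarrow> P q \<Longrightarrow> P (p + q)"
  shows "P p"
proof (induction p rule: update_induct)
  case const
  then show ?case by (simp add: assms(1))
next
  case (update p a b)
  have "Poly_Mapping.update a b p = p + Poly_Mapping.single a b"
    using update by (intro poly_mapping_eqI)
      (auto simp: lookup_update lookup_add lookup_single in_keys_iff when_def)
  then show ?case
    using assms update by simp
qed

section \<open>The free associative algebra\<close>

text \<open>The wrapper carries concatenation as its addition, so that convolution makes
  \<open>word \<Rightarrow>\<^sub>0 'k\<close> the monoid algebra of words, that is, the free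
  algebra. All natural numbers are letters; the bound \<open>m\<close> enters through
  \<open>words m n\<close>.\<close>

datatype word = Word (letters: "nat list")

instantiation word :: monoid_add
begin
definition zero_word_def: "0 = Word []"
definition plus_word_def: "u + v = Word (letters u @ letters v)"
instance
  by standard (simp_all add: zero_word_def plus_word_def)
end

lemma letters_zero [simp]: "letters 0 = []"
  and letters_plus [simp]: "letters (u + v) = letters u @ letters v"
  by (simp_all add: zero_word_def plus_word_def)

type_synonym 'k walg = "word \<Rightarrow>\<^sub>0 'k"

definition wscale :: "'k::field \<Rightarrow> 'k walg \<Rightarrow> 'k walg" where
  "wscale c p = Poly_Mapping.single 0 c * p"

interpretation R: vector_space wscale
  by unfold_locales
    (simp_all add: wscale_def algebra_simps single_add mult_single flip: mult.assoc)

text \<open>The empty word is neutral on both sides, so constants commute with everything and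
  scalars can be pulled out of a right factor as well.\<close>

lemma single_zero_central: "p * Poly_Mapping.single (0::word) (c::'k::field) = Poly_Mapping.single 0 c * p"
  by (induction p rule: poly_mapping_single_induct) (simp_all add: mult_single algebra_simps)

lemma wscale_mult_left: "wscale c p * q = wscale c (p * q)"
  by (simp add: wscale_def mult.assoc)

lemma wscale_mult_right: "p * wscale c q = wscale c (p * q)"
  by (metis wscale_def mult.assoc single_zero_central)

lemma lookup_wscale: "Poly_Mapping.lookup (wscale c p) w = c * Poly_Mapping.lookup p w"
  by (simp add: wscale_def map.rep_eq when_def flip: mult_map_scale_conv_mult)

definition X :: "word \<Rightarrow> 'k::field walg" where
  "X w = Poly_Mapping.single w 1"

lemma X_plus: "X (u + v) = X u * X v"
  by (simp add: X_def mult_single)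

lemma X_zero: "X 0 = 1"
  by (simp add: X_def)

lemma single_eq_wscale: "Poly_Mapping.single w c = wscale c (X w)"
  by (simp add: X_def wscale_def mult_single)

lemma walg_eq_sum: "p = (\<Sum>w\<in>Poly_Mapping.keys p. wscale (Poly_Mapping.lookup p w) (X w))"
proof (rule poly_mapping_eqI)
  fix v
  show "Poly_Mapping.lookup p v
      = Poly_Mapping.lookup (\<Sum>w\<in>Poly_Mapping.keys p. wscale (Poly_Mapping.lookup p w) (X w)) v"
    by (cases "v \<in> Poly_Mapping.keys p")
      (auto simp: lookup_sum lookup_single in_keys_iff when_def sum.If_cases simp flip: single_eq_wscale
        intro!: sum.neutral)
qed

lemma in_span_X_iff: "p \<in> R.span (X ` A) \<longleftrightarrow> Poly_Mapping.keys p \<subseteq> A"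
proof
  assume "p \<in> R.span (X ` A)"
  then show "Poly_Mapping.keys p \<subseteq> A"
  proof (induction rule: R.span_induct_alt)
    case base
    then show ?case by simp
  next
    case (step c x y)
    then have "Poly_Mapping.keys (wscale c x) \<subseteq> A"
      by (auto simp: simp flip: single_eq_wscale split: if_splits)
    then show ?case
      using step keys_add[of "wscale c x" y] by blast
  qed
next
  assume "Poly_Mapping.keys p \<subseteq> A"
  then show "p \<in> R.span (X ` A)"
    by (subst walg_eq_sum) (intro R.span_sum R.span_scale R.span_base, auto)
qed

lemma span_X_UNIV: "R.span (range X) = UNIV"
  using in_span_X_iff[of _ UNIV] by auto

lemma inj_X: "inj X"
  by (rule injI) (metis X_def keys_single singleton_inject zero_neq_one)

lemma independent_X:
  assumes "finite A"
  shows "R.independent (X ` A :: 'a::field walg set)"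
proof (rule R.independent_if_scalars_zero)
  fix f :: "'a walg \<Rightarrow> 'a" and x :: "'a walg"
  assume sum: "(\<Sum>x\<in>X ` A. wscale (f x) x) = 0" and "x \<in> X ` A"
  then obtain w where w: "w \<in> A" "x = X w" by auto
  have "0 = (\<Sum>x\<in>X ` A. wscale (f x) x)"
    using sum by simp
  also have "\<dots> = (\<Sum>v\<in>A. wscale (f (X v)) (X v))"
    by (simp add: sum.reindex inj_on_subset[OF inj_X])
  finally have "0 = (\<Sum>v\<in>A. Poly_Mapping.lookup (wscale (f (X v)) (X v)) w)"
    by (metis lookup_sum lookup_zero)
  also have "\<dots> = f x"
    using assms w by (simp add: lookup_single when_def flip: single_eq_wscale)
  finally show "f x = 0" by simp
qed (use assms in simp)

text \<open>By bilinearity it is enough to multiply spanning elements: the right factor is expanded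
  first, then the left one.\<close>

lemma span_mult:
  assumes "R.subspace S" and "\<And>a b. a \<in> A \<Longrightarrow> b \<in> B \<Longrightarrow> a * b \<in> S"
    and "p \<in> R.span A" and "q \<in> R.span B"
  shows "p * q \<in> S"
proof -
  have *: "a * q \<in> S" if "a \<in> A" for a
    using \<open>q \<in> R.span B\<close>
  proof (induction rule: R.span_induct_alt)
    case base
    then show ?case using assms(1) by (simp add: R.subspace_0)
  next
    case (step c x y)
    then show ?case using assms(1,2) that
      by (simp add: distrib_left wscale_mult_right R.subspace_add R.subspace_scale)
  qed
  show ?thesis
    using \<open>p \<in> R.span A\<close>
  proof (induction rule: R.span_induct_alt)
    case base
    then show ?case using assms(1) by (simp add: R.subspace_0)
  next
    case (step c x y)
    then show ?case using assms(1) *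
      by (simp add: distrib_right wscale_mult_left R.subspace_add R.subspace_scale)
  qed
qed

section \<open>Words of given length and homogeneous components\<close>

definition words :: "nat \<Rightarrow> nat \<Rightarrow> word set" where
  "words m n = {w. set (letters w) \<subseteq> {..<m} \<and> length (letters w) = n}"

definition hom :: "nat \<Rightarrow> nat \<Rightarrow> 'k::field walg set" where
  "hom m n = R.span (X ` words m n)"

lemma words_eq_image: "words m n = Word ` {xs. set xs \<subseteq> {..<m} \<and> length xs = n}"
  by (auto simp: words_def image_iff intro: word.exhaust_sel)

lemma finite_words: "finite (words m n)"
  by (simp add: words_eq_image finite_lists_length_eq)

lemma card_words: "card (words m n) = m ^ n"
  by (simp add: words_eq_image card_image inj_on_def card_lists_length_eq)

lemma words_plus: "u \<in> words m i \<Longrightarrow> v \<in> words m j \<Longrightarrow> u + v \<in> words m (i + j)"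
  by (auto simp: words_def)

lemma words_0: "words m 0 = {0}"
  by (auto simp: words_def zero_word_def intro: word.expand)

lemma words_Suc_obtain:
  assumes "w \<in> words m (Suc n)"
  obtains v a where "w = v + Word [a]" "v \<in> words m n" "a < m"
proof -
  obtain xs x where "letters w = xs @ [x]"
    using assms by (cases "letters w" rule: rev_cases) (auto simp: words_def)
  then have "w = Word xs + Word [x]" "Word xs \<in> words m n" "x < m"
    using assms by (auto simp: words_def intro: word.expand)
  then show ?thesis by (rule that)
qed

lemma hom_mult: "p \<in> hom m i \<Longrightarrow> q \<in> hom m j \<Longrightarrow> p * q \<in> hom m (i + j)"
  unfolding hom_def
  by (rule span_mult[OF R.subspace_span]) (auto simp flip: X_plus intro!: R.span_base words_plus)

section \<open>The Golod-Shafarevich inequality\<close>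

text \<open>Each relation is stored with a degree, because a relation may be 0 and the dimension
  count still needs a weight for it. The multipliers are words in all letters.\<close>

definition two_sided_ideal :: "(nat \<times> 'k::field walg) set \<Rightarrow> 'k walg set" where
  "two_sided_ideal \<Gamma> = R.span {X u * f * X v |u v j f. (j, f) \<in> \<Gamma>}"

text \<open>Here the multipliers use only letters below \<open>m\<close>, and the total degree is
  fixed; this is the degree \<open>n\<close> part of the ideal in the free algebra on
  \<open>m\<close> letters.\<close>

definition ideal_part :: "nat \<Rightarrow> (nat \<times> 'k::field walg) set \<Rightarrow> nat \<Rightarrow> 'k walg set" where
  "ideal_part m \<Gamma> n = R.span {X u * f * X v |u v j f i l.
     (j, f) \<in> \<Gamma> \<and> u \<in> words m i \<and> v \<in> words m l \<and> n = i + j + l}"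

lemma ideal_mult_left:
  assumes "q \<in> two_sided_ideal \<Gamma>"
  shows "p * q \<in> two_sided_ideal \<Gamma>"
proof -
  have "p \<in> R.span (range X)"
    by (simp add: span_X_UNIV)
  from R.subspace_span _ this assms[unfolded two_sided_ideal_def] show ?thesis
    unfolding two_sided_ideal_def
  proof (rule span_mult)
    fix a b :: "'a walg"
    assume "a \<in> range X" "b \<in> {X u * f * X v |u v j f. (j, f) \<in> \<Gamma>}"
    then obtain w u v j f where "a = X w" "b = X u * f * X v" "(j, f) \<in> \<Gamma>" by blast
    then have "a * b = X (w + u) * f * X v" "(j, f) \<in> \<Gamma>"
      by (simp_all add: X_plus mult.assoc)
    then show "a * b \<in> R.span {X u * f * X v |u v j f. (j, f) \<in> \<Gamma>}"
      by (intro R.span_base) blast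
  qed
qed

lemma ideal_mult_right:
  assumes "p \<in> two_sided_ideal \<Gamma>"
  shows "p * q \<in> two_sided_ideal \<Gamma>"
proof -
  have "q \<in> R.span (range X)"
    by (simp add: span_X_UNIV)
  from R.subspace_span _ assms[unfolded two_sided_ideal_def] this show ?thesis
    unfolding two_sided_ideal_def
  proof (rule span_mult)
    fix a b :: "'a walg"
    assume "b \<in> range X" "a \<in> {X u * f * X v |u v j f. (j, f) \<in> \<Gamma>}"
    then obtain w u v j f where "b = X w" "a = X u * f * X v" "(j, f) \<in> \<Gamma>" by blast
    then have "a * b = X u * f * X (v + w)" "(j, f) \<in> \<Gamma>"
      by (simp_all add: X_plus mult.assoc)
    then show "a * b \<in> R.span {X u * f * X v |u v j f. (j, f) \<in> \<Gamma>}"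
      by (intro R.span_base) blast
  qed
qed

lemma subspace_ideal: "R.subspace (two_sided_ideal \<Gamma>)"
  by (simp add: two_sided_ideal_def)

lemma relation_in_ideal:
  assumes "(j, f) \<in> \<Gamma>"
  shows "f \<in> two_sided_ideal \<Gamma>"
proof -
  have "X 0 * f * X 0 \<in> two_sided_ideal \<Gamma>"
    unfolding two_sided_ideal_def using assms by (intro R.span_base) blast
  then show ?thesis by (simp add: X_zero)
qed

text \<open>After division by \<open>\<beta>\<close>, the condition \<open>weight\<close> says that
  the partial sums of the Golod-Shafarevich series 1 - m t + \<Sum> t^j are at most 0 at t =
  1/\<beta>.\<close>

locale golod_shafarevich =
  fixes m :: nat and \<Gamma> :: "(nat \<times> 'k::field walg) set" and \<beta> :: real
  assumes degree_pos: "(j, f) \<in> \<Gamma> \<Longrightarrow> 1 \<le> j"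
    and homogeneous: "(j, f) \<in> \<Gamma> \<Longrightarrow> f \<in> hom m j"
    and finite_below: "finite {(j, f) \<in> \<Gamma>. j \<le> n}"
    and \<beta>_pos: "0 < \<beta>"
    and weight: "(\<Sum>(j, f) \<in> {(j, f) \<in> \<Gamma>. j \<le> n}. (1 / \<beta>) ^ (j - 1)) \<le> m - \<beta>"
begin

abbreviation "I \<equiv> ideal_part m \<Gamma>"

text \<open>Projection to the span of \<open>words m n\<close> maps each spanning element
  \<open>X u * f * X v\<close> to itself or to 0, since \<open>f\<close> is homogeneous, and hence
  maps the whole ideal into \<open>I n\<close>.\<close>

lemma homogeneous_in_ideal:
  assumes "p \<in> two_sided_ideal \<Gamma>" and "Poly_Mapping.keys p \<subseteq> words m n"
  shows "p \<in> I n"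
proof -
  define restr :: "'k walg \<Rightarrow> 'k walg"
    where "restr = Poly_Mapping.mapp (\<lambda>w c. c when w \<in> words m n)"
  have lookup_restr: "Poly_Mapping.lookup (restr q) w = (Poly_Mapping.lookup q w when w \<in> words m n)" for q w
    by (auto simp: restr_def lookup_mapp when_def in_keys_iff)
  have restr_step: "restr (wscale c q + r) = wscale c (restr q) + restr r" for c q r
    by (rule poly_mapping_eqI) (simp add: lookup_restr lookup_add lookup_wscale when_def)
  have restr_id: "restr q = q" if "Poly_Mapping.keys q \<subseteq> words m n" for q
    using that by (intro poly_mapping_eqI) (auto simp: lookup_restr in_keys_iff when_def)
  have restr_0: "restr q = 0" if "Poly_Mapping.keys q \<inter> words m n = {}" for q
    using that by (intro poly_mapping_eqI) (auto simp: lookup_restr in_keys_iff when_def)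
  have "restr p \<in> I n"
    using assms(1) unfolding two_sided_ideal_def
  proof (induction rule: R.span_induct_alt)
    case base
    have "restr 0 = 0" by (rule restr_0) simp
    then show ?case by (simp add: ideal_part_def R.span_zero)
  next
    case (step c x y)
    then obtain u v j f where x: "x = X u * f * X v" and \<Gamma>: "(j, f) \<in> \<Gamma>" by blast
    have "X u * f * X v \<in> R.span (X ` {u + w + v |w. w \<in> words m j})"
    proof (rule span_mult[OF R.subspace_span])
      show "X u * f \<in> R.span (X ` {u + w |w. w \<in> words m j})"
        by (rule span_mult[OF R.subspace_span, of "{X u}" "X ` words m j"])
          (use homogeneous[OF \<Gamma>] in \<open>auto simp: hom_def R.span_base intro!: R.span_base simp flip: X_plus\<close>)
      show "X v \<in> R.span {X v}" by (simp add: R.span_base)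
    qed (auto intro!: R.span_base simp flip: X_plus)
    then have keys: "Poly_Mapping.keys x \<subseteq> {u + w + v |w. w \<in> words m j}"
      by (simp add: in_span_X_iff x)
    have "restr x \<in> I n"
    proof (cases "\<exists>i l. u \<in> words m i \<and> v \<in> words m l \<and> n = i + j + l")
      case True
      then have "Poly_Mapping.keys x \<subseteq> words m n"
        using keys by (fastforce intro: words_plus)
      then have "restr x = x" by (rule restr_id)
      moreover have "x \<in> I n"
        unfolding ideal_part_def using True x \<Gamma> by (intro R.span_base) blast
      ultimately show ?thesis by simp
    next
      \<comment> \<open>Either \<open>u\<close> or \<open>v\<close> has a letter outside
        \<open>{..<m}\<close>, or the total length differs from \<open>n\<close>; both exclude every
        key \<open>u + w + v\<close>.\<close>
      case False
      then have "Poly_Mapping.keys x \<inter> words m n = {}"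
        using keys by (fastforce simp: words_def)
      then show ?thesis by (simp add: restr_0 ideal_part_def R.span_zero)
    qed
    then show ?case
      using step.IH unfolding restr_step by (simp add: ideal_part_def R.span_add R.span_scale)
  qed
  then show ?thesis by (simp add: restr_id assms(2))
qed

lemma ideal_part_mult_hom:
  assumes "p \<in> I k" and "q \<in> hom m l"
  shows "p * q \<in> I (k + l)"
proof -
  have "p * q \<in> ideal_part m \<Gamma> (k + l)"
    using _ _ assms[unfolded ideal_part_def hom_def]
  proof (rule span_mult)
    show "R.subspace (I (k + l))" by (simp add: ideal_part_def)
    fix a b :: "'k walg"
    assume "a \<in> {X u * f * X v |u v j f i l. (j, f) \<in> \<Gamma> \<and> u \<in> words m i \<and> v \<in> words m l \<and> k = i + j + l}"
      and "b \<in> X ` words m l"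
    then obtain u v j f i l' w where *: "a = X u * f * X v" "(j, f) \<in> \<Gamma>" "u \<in> words m i"
        "v \<in> words m l'" "k = i + j + l'" "b = X w" "w \<in> words m l"
      by blast
    then have "a * b = X u * f * X (v + w)" "v + w \<in> words m (l' + l)" "k + l = i + j + (l' + l)"
      by (simp_all add: X_plus mult.assoc words_plus)
    then show "a * b \<in> I (k + l)"
      unfolding ideal_part_def using * by (intro R.span_base) blast
  qed
  then show ?thesis .
qed

lemma ideal_part_subset_hom: "I n \<subseteq> hom m n"
  unfolding ideal_part_def
proof (rule R.span_minimal)
  show "R.subspace (hom m n)" by (simp add: hom_def)
  have X: "X u \<in> hom m i" if "u \<in> words m i" for u i
    using that by (simp add: hom_def R.span_base)
  show "{X u * f * X v |u v j f i l. (j, f) \<in> \<Gamma> \<and> u \<in> words m i \<and> v \<in> words m l \<and> n = i + j + l} \<subseteq> hom m n"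
    using X homogeneous by (auto intro!: hom_mult)
qed

lemma ideal_part_0: "I 0 = {0}"
proof -
  have "{X u * f * X v |u v j f i l. (j, f) \<in> \<Gamma> \<and> u \<in> words m i \<and> v \<in> words m l \<and> 0 = i + j + l} = {}"
    using degree_pos by force
  then show ?thesis by (simp only: ideal_part_def R.span_empty)
qed

text \<open>A basis \<open>B\<close> of \<open>I n\<close> is extended to a basis of
  \<open>hom m n\<close>. The added vectors \<open>S\<close> represent a basis of the degree
  \<open>n\<close> part of the quotient, so \<open>card S\<close> is the codimension to be bounded
  below.\<close>

lemma hom_basis:
  "\<exists>B S. finite B \<and> finite S \<and> B \<subseteq> I n \<and> I n \<subseteq> R.span B \<and> hom m n \<subseteq> R.span (B \<union> S)
     \<and> card B = R.dim (I n) \<and> card B + card S = m ^ n"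
proof -
  have indep: "R.independent (X ` words m n :: 'k walg set)"
    by (rule independent_X[OF finite_words])
  obtain B where B: "B \<subseteq> I n" "R.independent B" "I n \<subseteq> R.span B" "card B = R.dim (I n)"
    by (rule R.basis_exists)
  obtain C where C: "B \<subseteq> C" "C \<subseteq> hom m n" "R.independent C" "hom m n \<subseteq> R.span C"
    by (rule R.maximal_independent_subset_extend[OF subset_trans[OF B(1) ideal_part_subset_hom] B(2)])
  have "finite C"
    using R.independent_span_bound[of "X ` words m n" C] C finite_words by (auto simp: hom_def)
  have "card C = R.dim (hom m n :: 'k walg set)"
    by (rule R.basis_card_eq_dim[OF C(2,4,3)])
  also have "\<dots> = card (X ` words m n :: 'k walg set)"
    unfolding hom_def by (rule R.dim_span_eq_card_independent[OF indep])
  also have "\<dots> = m ^ n"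
    by (simp add: card_image inj_on_subset[OF inj_X] card_words)
  finally have "card C = m ^ n" .
  then have "card B + card (C - B) = m ^ n"
    using \<open>finite C\<close> C(1) by (metis card_Diff_subset card_mono finite_subset le_add_diff_inverse)
  then show ?thesis
    using B C \<open>finite C\<close> finite_subset
    by (intro exI[of _ B] exI[of _ "C - B"]) (auto simp: Un_absorb1)
qed

text \<open>
  An element \<open>u f v\<close> of the ideal with \<open>v\<close> nonempty lies in \<open>I (n - 1)\<close> times a letter; if \<open>v\<close> is
  empty, \<open>u\<close> may be reduced modulo the ideal, because \<open>I k * f\<close> again ends with a letter.
\<close>

lemma ideal_part_Suc_subset:
  assumes "I n \<subseteq> R.span B" and "B \<subseteq> I n" and "\<And>k. hom m k \<subseteq> R.span (I k \<union> S k)"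
  shows "I (Suc n) \<subseteq> R.span ((\<lambda>(b, a). b * X (Word [a])) ` (B \<times> {..<m})
           \<union> (\<Union>(j, f) \<in> {(j, f) \<in> \<Gamma>. j \<le> Suc n}. (\<lambda>s. s * f) ` S (Suc n - j)))"
    (is "_ \<subseteq> R.span ?Z")
proof -
  have last: "p * X (Word [a]) \<in> R.span ?Z" if "p \<in> I n" "a < m" for p a
    by (rule span_mult[OF R.subspace_span, of B "{X (Word [a])}"])
      (use that assms(1) in \<open>auto intro: R.span_base\<close>)
  have letter: "p * q \<in> R.span ?Z" if p: "p \<in> I k" and q: "q \<in> hom m l" and kl: "k + l = Suc n" "1 \<le> l" for p q k l
  proof (rule span_mult[OF R.subspace_span])
    show "p \<in> R.span {p}" by (simp add: R.span_base)
    show "q \<in> R.span (X ` words m l)" using q by (simp add: hom_def)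
    fix a b :: "'k walg"
    assume ab: "a \<in> {p}" "b \<in> X ` words m l"
    then obtain w where w: "w \<in> words m l" "b = X w" by blast
    obtain l' where l': "l = Suc l'" using kl by (cases l) auto
    obtain v c where v: "w = v + Word [c]" "v \<in> words m l'" "c < m"
      using w l' words_Suc_obtain by metis
    have "p * X v \<in> I (k + l')"
      by (rule ideal_part_mult_hom[OF p]) (use v in \<open>simp add: hom_def R.span_base\<close>)
    moreover have "k + l' = n" using kl l' by simp
    ultimately have "(p * X v) * X (Word [c]) \<in> R.span ?Z"
      using last v by simp
    then show "a * b \<in> R.span ?Z"
      using ab w v by (simp add: X_plus mult.assoc)
  qed
  show ?thesis
    unfolding ideal_part_def
  proof (rule R.span_minimal[OF _ R.subspace_span], safe)
    fix u v j f i l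
    assume \<Gamma>: "(j, f) \<in> \<Gamma>" and u: "u \<in> words m i" and v: "v \<in> words m l" and n: "Suc n = i + j + l"
    show "X u * f * X v \<in> R.span ?Z"
    proof (cases l)
      case (Suc l')
      have "X u * f * X 0 \<in> I (i + j)"
        unfolding ideal_part_def using \<Gamma> u words_0 by (intro R.span_base) fastforce
      then show ?thesis
        using v n Suc by (intro letter[of _ "i + j" _ l]) (auto simp: X_zero hom_def R.span_base)
    next
      case 0
      have "X u * f \<in> R.span ?Z"
      proof (rule span_mult[OF R.subspace_span])
        show "X u \<in> R.span (I i \<union> S i)"
          using assms(3)[of i] u by (auto simp: hom_def R.span_base)
        show "f \<in> R.span {f}" by (simp add: R.span_base)
        fix a b :: "'k walg"
        assume a: "a \<in> I i \<union> S i" and b: "b \<in> {f}"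
        show "a * b \<in> R.span ?Z"
        proof (cases "a \<in> I i")
          case True
          then show ?thesis
            using b n 0 homogeneous[OF \<Gamma>] degree_pos[OF \<Gamma>] by (intro letter[of _ i _ j]) auto
        next
          case False
          then have "a \<in> S (Suc n - j)" "j \<le> Suc n" using a n 0 by simp_all
          then show ?thesis
            using b \<Gamma> by (intro R.span_base UnI2) auto
        qed
      qed
      then show ?thesis using v 0 by (simp add: words_0 X_zero)
    qed
  qed
qed

text \<open>The codimensions \<open>s n\<close> grow at least by the factor \<open>\<beta>\<close>
  in each step: by induction earlier values satisfy s (n - i) \<le> \<beta>^(-i) s n, and
  \<open>weight\<close> then absorbs the loss caused by the relations.\<close>

lemma codim_growth: "\<beta> ^ n \<le> m ^ n - real (R.dim (I n))"
proof -
  obtain B S where finB: "\<And>n. finite (B n)" and finS: "\<And>n. finite (S n)" and BI: "\<And>n. B n \<subseteq> I n"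
    and IB: "\<And>n. I n \<subseteq> R.span (B n)" and hom: "\<And>n. hom m n \<subseteq> R.span (B n \<union> S n)"
    and cardB: "\<And>n. card (B n) = R.dim (I n)" and card: "\<And>n. card (B n) + card (S n) = m ^ n"
    using hom_basis by metis
  have homIS: "hom m n \<subseteq> R.span (I n \<union> S n)" for n
    using hom[of n] R.span_mono[of "B n \<union> S n" "I n \<union> S n"] BI[of n] by blast
  define s where "s n = real (card (S n))" for n
  have s_eq: "s n = m ^ n - real (R.dim (I n))" for n
    using card[of n] cardB[of n] by (simp add: s_def) (metis of_nat_add of_nat_power add_diff_cancel_left')
  \<comment> \<open>The spanning set of \<open>I (Suc n)\<close> has at most
    \<open>card (B n) * m\<close> products with a letter, and at most
    \<open>card (S (Suc n - j))\<close> elements for each relation of degree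
    \<open>j\<close>.\<close>
  have rec: "m * s n - (\<Sum>(j, f) \<in> {(j, f) \<in> \<Gamma>. j \<le> Suc n}. s (Suc n - j)) \<le> s (Suc n)" for n
  proof -
    let ?G = "{(j, f) \<in> \<Gamma>. j \<le> Suc n}"
    let ?A = "(\<lambda>(b, a). b * X (Word [a])) ` (B n \<times> {..<m})"
    let ?C = "\<Union>(j, f) \<in> ?G. (\<lambda>s. s * f) ` S (Suc n - j)"
    have fin: "finite ?A" "finite ?C"
      using finB finS finite_below[of "Suc n"] by auto
    have "R.dim (I (Suc n)) \<le> card (?A \<union> ?C)"
      using fin by (intro R.dim_le_card ideal_part_Suc_subset IB BI homIS) auto
    also have "\<dots> \<le> card ?A + card ?C"
      by (rule card_Un_le)
    also have "card ?A \<le> card (B n) * m"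
      using card_image_le[of "B n \<times> {..<m}"] finB by (simp add: card_cartesian_product)
    also have "card ?C \<le> (\<Sum>(j, f) \<in> ?G. card (S (Suc n - j)))"
      using card_UN_le[OF finite_below[of "Suc n"], of "\<lambda>(j, f). (\<lambda>s. s * f) ` S (Suc n - j)"]
      by (rule order_trans) (auto intro!: sum_mono card_image_le finS)
    finally have "R.dim (I (Suc n)) \<le> card (B n) * m + (\<Sum>(j, f) \<in> ?G. card (S (Suc n - j)))"
      by simp
    then have "real (R.dim (I (Suc n))) \<le> real (card (B n) * m + (\<Sum>(j, f) \<in> ?G. card (S (Suc n - j))))"
      by (rule of_nat_mono)
    also have "\<dots> = real (card (B n)) * m + (\<Sum>(j, f) \<in> ?G. s (Suc n - j))"
      by (simp add: s_def case_prod_beta)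
    finally have "real (R.dim (I (Suc n))) \<le> real (card (B n)) * m + (\<Sum>(j, f) \<in> ?G. s (Suc n - j))" .
    then show ?thesis
      by (simp add: s_eq cardB algebra_simps)
  qed
  have mono: "\<beta> * s n \<le> s (Suc n)" for n
  proof (induction n rule: less_induct)
    case (less n)
    have down: "s (n - i) \<le> (1 / \<beta>) ^ i * s n" if "i \<le> n" for i
      using that
    proof (induction i)
      case 0
      then show ?case by simp
    next
      case (Suc i)
      have "\<beta> * s (n - Suc i) \<le> s (Suc (n - Suc i))"
        using Suc.prems by (intro less.IH) simp
      also have "Suc (n - Suc i) = n - i" using Suc.prems by simp
      also have "s (n - i) \<le> (1 / \<beta>) ^ i * s n" using Suc by simp
      finally show ?case using \<beta>_pos by (simp add: field_simps)
    qed
    have "(\<Sum>(j, f) \<in> {(j, f) \<in> \<Gamma>. j \<le> Suc n}. s (Suc n - j))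
        \<le> (\<Sum>(j, f) \<in> {(j, f) \<in> \<Gamma>. j \<le> Suc n}. (1 / \<beta>) ^ (j - 1) * s n)"
    proof (rule sum_mono, clarify)
      fix j f
      assume "(j, f) \<in> \<Gamma>" "j \<le> Suc n"
      \<comment> \<open>Degree \<open>Suc n - j\<close> is \<open>j - 1\<close> steps below
        \<open>n\<close>; hence the exponent \<open>j - 1\<close> in \<open>weight\<close>.\<close>
      then have "1 \<le> j" "j - 1 \<le> n" "Suc n - j = n - (j - 1)"
        using degree_pos by auto
      then show "s (Suc n - j) \<le> (1 / \<beta>) ^ (j - 1) * s n"
        using down[of "j - 1"] by simp
    qed
    also have "\<dots> = (\<Sum>(j, f) \<in> {(j, f) \<in> \<Gamma>. j \<le> Suc n}. (1 / \<beta>) ^ (j - 1)) * s n"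
      by (simp add: sum_distrib_right case_prod_beta)
    also have "\<dots> \<le> (m - \<beta>) * s n"
      using weight[of "Suc n"] by (intro mult_right_mono) (simp_all add: s_def)
    finally show ?case
      using rec[of n] by (simp add: algebra_simps)
  qed
  have "\<beta> ^ n \<le> s n"
  proof (induction n)
    case 0
    have "R.dim (I 0) = 0"
      using R.dim_le_card[of "I 0" "{}"] by (simp add: ideal_part_0)
    then show ?case by (simp add: s_eq)
  next
    case (Suc n)
    then have "\<beta> ^ Suc n \<le> \<beta> * s n" using \<beta>_pos by simp
    then show ?case using mono[of n] by simp
  qed
  then show ?thesis by (simp add: s_eq)
qed

text \<open>Otherwise \<open>I n\<close> would be all of \<open>hom m n\<close>, of codimension 0,
  while the codimension is at least \<beta>^n > 0.\<close>

theorem ideal_misses_word: "\<exists>w \<in> words m n. X w \<notin> two_sided_ideal \<Gamma>"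
proof (rule ccontr)
  assume "\<not> ?thesis"
  then have "X ` words m n \<subseteq> I n"
    by (auto intro!: homogeneous_in_ideal simp: X_def)
  then have "R.span (X ` words m n) \<subseteq> I n"
    by (rule R.span_minimal) (simp add: ideal_part_def)
  then have "hom m n = I n"
    using ideal_part_subset_hom by (auto simp: hom_def)
  moreover have "R.dim (hom m n :: 'k walg set) = m ^ n"
    unfolding hom_def
    using R.dim_span_eq_card_independent[OF independent_X[OF finite_words]]
    by (simp add: card_image inj_on_subset[OF inj_X] card_words)
  ultimately show False
    using codim_growth[of n] zero_less_power[OF \<beta>_pos, of n] by simp
qed

end

section \<open>Golod's relations\<close>

text \<open>A multiset over \<open>P\<close> is determined by its multiplicities on
  \<open>P\<close>, each at most \<open>N\<close>. For fixed \<open>P\<close> the bound is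
  polynomial in \<open>N\<close>.\<close>

lemma multisets_bounded:
  assumes "finite P"
  shows "finite {M. set_mset M \<subseteq> P \<and> size M = N}"
    and "card {M. set_mset M \<subseteq> P \<and> size M = N} \<le> (N + 1) ^ card P"
proof -
  let ?A = "{M. set_mset M \<subseteq> P \<and> size M = N}" and ?B = "P \<rightarrow>\<^sub>E {..N}"
  have inj: "inj_on (\<lambda>M. restrict (count M) P) ?A"
  proof (rule inj_onI, rule multiset_eqI)
    fix M M' x
    assume *: "M \<in> ?A" "M' \<in> ?A" and eq: "restrict (count M) P = restrict (count M') P"
    show "count M x = count M' x"
    proof (cases "x \<in> P")
      case True
      then show ?thesis using fun_cong[OF eq, of x] by simp
    next
      case False
      then have "x \<notin># M" "x \<notin># M'" using * by auto
      then show ?thesis by (simp add: not_in_iff)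
    qed
  qed
  have sub: "(\<lambda>M. restrict (count M) P) ` ?A \<subseteq> ?B"
    by (auto simp: count_le_size)
  have fin: "finite ?B" using assms by (intro finite_PiE) auto
  show "finite ?A"
    using finite_imageD[OF finite_subset[OF sub fin] inj] .
  have "card ?A \<le> card ?B"
    by (rule card_inj_on_le[OF inj sub fin])
  also have "\<dots> = (N + 1) ^ card P" using assms by (simp add: card_PiE)
  finally show "card ?A \<le> (N + 1) ^ card P" .
qed

text \<open>With \<open>y\<close> the root of \<open>x\<close> of order \<open>Suc q\<close>, the
  sequence x^N (N + 1)^(q + 1) is a power of (N + 1) y^N, which tends to 0. Using
  \<open>Suc q\<close> keeps the order of the root positive, and the extra factor N + 1 only
  enlarges the terms.\<close>

lemma exponential_beats_polynomial:
  fixes x e :: real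
  assumes "0 < x" "x < 1" "0 < e"
  shows "\<exists>N\<ge>n. x ^ N * (real N + 1) ^ q \<le> e"
proof -
  define y where "y = root (Suc q) x"
  have y: "0 < y" "y < 1" "y ^ Suc q = x"
    using assms real_root_pow_pos2[of "Suc q" x] by (simp_all add: y_def del: power_Suc)
  have "(\<lambda>N. real N * y ^ N + y ^ N) \<longlonglongrightarrow> 0 + 0"
    using y by (intro tendsto_add powser_times_n_limit_0 LIMSEQ_power_zero) auto
  then have "(\<lambda>N. (real N * y ^ N + y ^ N) ^ Suc q) \<longlonglongrightarrow> (0 + 0) ^ Suc q"
    by (rule tendsto_power)
  moreover have "(real N * y ^ N + y ^ N) ^ Suc q = x ^ N * (real N + 1) ^ Suc q" for N
  proof -
    have "real N * y ^ N + y ^ N = y ^ N * (real N + 1)"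
      by (simp add: algebra_simps)
    then have "(real N * y ^ N + y ^ N) ^ Suc q = (y ^ N) ^ Suc q * (real N + 1) ^ Suc q"
      by (simp only: power_mult_distrib)
    also have "(y ^ N) ^ Suc q = (y ^ Suc q) ^ N"
      by (metis power_mult mult.commute)
    finally show ?thesis by (simp only: y(3))
  qed
  ultimately have "(\<lambda>N. x ^ N * (real N + 1) ^ Suc q) \<longlonglongrightarrow> 0"
    by simp
  then have "\<forall>\<^sub>F N in sequentially. x ^ N * (real N + 1) ^ Suc q < e"
    by (rule order_tendstoD) fact
  then obtain N0 where N0: "\<And>N. N \<ge> N0 \<Longrightarrow> x ^ N * (real N + 1) ^ Suc q < e"
    by (auto simp: eventually_sequentially)
  have "x ^ N * (real N + 1) ^ q \<le> x ^ N * (real N + 1) ^ Suc q" for N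
    using assms(1) by (intro mult_left_mono power_increasing) auto
  then have "x ^ max n N0 * (real (max n N0) + 1) ^ q \<le> e"
    using N0[of "max n N0"] by (meson less_imp_le max.cobounded2 order_trans)
  then show ?thesis by (meson max.cobounded1)
qed

section \<open>Coefficients of products of generic elements\<close>

definition short_words :: "nat \<Rightarrow> nat \<Rightarrow> word set" where
  "short_words m n = (\<Union>i\<in>{1..n}. words m i)"

definition word_lists :: "word set \<Rightarrow> nat \<Rightarrow> word list set" where
  "word_lists Q N = {ws. set ws \<subseteq> Q \<and> length ws = N}"

text \<open>
  \<open>rel Q is M\<close> is the coefficient of the monomial \<open>M\<close> in the commuting indeterminates
  \<open>c (i, w)\<close> when the product of the generic elements \<open>\<Sum>w\<in>Q. c (i, w) w\<close>, with \<open>i\<close>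
  running through the list \<open>is\<close>, is expanded.
\<close>

definition rel :: "word set \<Rightarrow> nat list \<Rightarrow> (nat \<times> word) multiset \<Rightarrow> 'k::field walg" where
  "rel Q is M = (\<Sum>ws \<in> {ws \<in> word_lists Q (length is). mset (zip is ws) = M}. X (sum_list ws))"

text \<open>The common length of all words that occur in \<open>rel Q is M\<close>; it is defined
  also when that sum is empty.\<close>

definition rel_degree :: "(nat \<times> word) multiset \<Rightarrow> nat" where
  "rel_degree M = (\<Sum>(i, w) \<in># M. length (letters w))"

definition golod_rels :: "nat \<Rightarrow> nat \<Rightarrow> nat \<Rightarrow> (nat \<times> 'k::field walg) set" where
  "golod_rels m n N = (\<lambda>(is, M). (rel_degree M, rel (short_words m n) is M)) `
     ({is. set is \<subseteq> {..<m - 1} \<and> length is = N} \<times>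
      {M. set_mset M \<subseteq> {..<m - 1} \<times> short_words m n \<and> size M = N})"

lemma finite_short_words: "finite (short_words m n)"
  by (simp add: short_words_def finite_words)

lemma finite_word_lists: "finite Q \<Longrightarrow> finite (word_lists Q N)"
  by (simp add: word_lists_def finite_lists_length_eq)

text \<open>The index list contributes the exponential factor and the multiset a polynomial one. The
  base \<open>m - 1\<close> stays below the growth rate \<open>m - 1 / 2\<close>, which is what
  limits the method to \<open>m - 1\<close> elements.\<close>

lemma golod_rels_bound:
  "finite (golod_rels m n N :: (nat \<times> 'k::field walg) set)"
  "card (golod_rels m n N :: (nat \<times> 'k walg) set) \<le> (m - 1) ^ N * (N + 1) ^ ((m - 1) * card (short_words m n))"
proof -
  let ?A = "{is. set is \<subseteq> {..<m - 1} \<and> length is = N}"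
  let ?B = "{M. set_mset M \<subseteq> {..<m - 1} \<times> short_words m n \<and> size M = N}"
  have finP: "finite ({..<m - 1} \<times> short_words m n)" by (simp add: finite_short_words)
  have fin: "finite ?A" "finite ?B"
    using finite_lists_length_eq[of "{..<m - 1}" N] multisets_bounded(1)[OF finP] by auto
  then show "finite (golod_rels m n N :: (nat \<times> 'k walg) set)"
    by (simp add: golod_rels_def)
  have "card (golod_rels m n N :: (nat \<times> 'k walg) set) \<le> card (?A \<times> ?B)"
    unfolding golod_rels_def using fin by (intro card_image_le) simp
  also have "\<dots> = (m - 1) ^ N * card ?B"
    by (simp only: card_cartesian_product card_lists_length_eq finite_lessThan card_lessThan)
  also have "\<dots> \<le> (m - 1) ^ N * (N + 1) ^ ((m - 1) * card (short_words m n))"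
    using multisets_bounded(2)[OF finP, of N] by (simp add: card_cartesian_product)
  finally show "card (golod_rels m n N :: (nat \<times> 'k walg) set)
     \<le> (m - 1) ^ N * (N + 1) ^ ((m - 1) * card (short_words m n))" .
qed

lemma letters_sum_list: "letters (sum_list ws) = concat (map letters ws)"
  by (induction ws) simp_all

text \<open>\<open>short_words\<close> excludes the empty word, so each of the \<open>N\<close>
  words in the multiset contributes at least 1 to the degree.\<close>

lemma golod_rels_degree:
  assumes "(j, f) \<in> golod_rels m n N"
  shows "N \<le> j"
proof -
  obtain M where M: "j = rel_degree M" "set_mset M \<subseteq> {..<m - 1} \<times> short_words m n" "size M = N"
    using assms by (auto simp: golod_rels_def)
  have "size M = (\<Sum>x \<in># M. 1)" by (rule size_eq_sum_mset)
  also have "\<dots> \<le> rel_degree M"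
    unfolding rel_degree_def
  proof (rule sum_mset_mono)
    fix x assume "x \<in># M"
    then have "x \<in> {..<m - 1} \<times> short_words m n" using M(2) by blast
    then obtain i w where x: "x = (i, w)" "w \<in> short_words m n" by blast
    then obtain l where "l \<in> {1..n}" "w \<in> words m l"
      unfolding short_words_def by blast
    then show "1 \<le> (case x of (i, w) \<Rightarrow> length (letters w))"
      by (simp add: words_def x)
  qed
  finally show ?thesis using M by simp
qed

lemma golod_rels_homogeneous:
  assumes "(j, f) \<in> golod_rels m n N"
  shows "f \<in> hom m j"
proof -
  obtain "is" M where f: "f = rel (short_words m n) is M" and j: "j = rel_degree M"
    using assms by (auto simp: golod_rels_def)
  show ?thesis
    unfolding f rel_def hom_def
  proof (intro R.span_sum R.span_base imageI)
    fix ws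
    assume "ws \<in> {ws \<in> word_lists (short_words m n) (length is). mset (zip is ws) = M}"
    then have ws: "set ws \<subseteq> short_words m n" "length ws = length is" "mset (zip is ws) = M"
      by (auto simp: word_lists_def)
    have "set (letters (sum_list ws)) \<subseteq> {..<m}"
      using ws(1) by (fastforce simp: letters_sum_list short_words_def words_def)
    moreover have "length (letters (sum_list ws)) = j"
    proof -
      have "j = sum_list (map (\<lambda>(i, w). length (letters w)) (zip is ws))"
        unfolding j rel_degree_def by (simp flip: ws(3) sum_mset_sum_list)
      also have "map (\<lambda>(i, w). length (letters w)) (zip is ws) = map (\<lambda>w. length (letters w)) (map snd (zip is ws))"
        by (simp add: case_prod_beta)
      also have "map snd (zip is ws) = ws"
        using ws(2) by simp
      finally show ?thesis
        by (simp add: letters_sum_list length_concat comp_def)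
    qed
    ultimately show "sum_list ws \<in> words m j"
      by (simp add: words_def)
  qed
qed

text \<open>Noncommutative distributivity: one term for each choice of a word in every factor. Words
  are concatenated in order, while the scalars are collected in front.\<close>

lemma prod_list_expand:
  fixes c :: "nat \<times> word \<Rightarrow> 'k::field"
  assumes "finite Q"
  shows "prod_list (map (\<lambda>i. \<Sum>w\<in>Q. wscale (c (i, w)) (X w)) is)
    = (\<Sum>ws \<in> word_lists Q (length is). wscale (prod_list (map c (zip is ws))) (X (sum_list ws)))"
proof (induction "is")
  case Nil
  have "word_lists Q 0 = {[]}" by (auto simp: word_lists_def)
  then show ?case by (simp add: X_zero)
next
  case (Cons i "is")
  let ?g = "\<lambda>ws. wscale (prod_list (map c (zip (i # is) ws))) (X (sum_list ws))"
  have eq: "word_lists Q (length (i # is)) = (\<lambda>(w, ws). w # ws) ` (Q \<times> word_lists Q (length is))"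
    by (auto simp: word_lists_def length_Suc_conv)
  have "sum ?g (word_lists Q (length (i # is))) = (\<Sum>(w, ws) \<in> Q \<times> word_lists Q (length is). ?g (w # ws))"
    unfolding eq by (subst sum.reindex) (auto simp: inj_on_def case_prod_beta)
  also have "\<dots> = (\<Sum>w\<in>Q. \<Sum>ws\<in>word_lists Q (length is). wscale (c (i, w)) (X w) *
      wscale (prod_list (map c (zip is ws))) (X (sum_list ws)))"
    by (simp add: sum.cartesian_product wscale_mult_left wscale_mult_right X_plus mult.commute)
  also have "\<dots> = (\<Sum>w\<in>Q. wscale (c (i, w)) (X w)) *
      (\<Sum>ws\<in>word_lists Q (length is). wscale (prod_list (map c (zip is ws))) (X (sum_list ws)))"
    by (simp add: sum_product)
  finally show ?case
    using Cons.IH by simp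
qed

text \<open>The terms of the expansion are grouped by the multiset \<open>mset (zip is ws)\<close>.
  Scalars commute, so the coefficient depends only on this multiset and each group is a scalar
  multiple of a relation. Thus finitely many relations, independent of \<open>c\<close>, handle all
  values of \<open>c\<close>.\<close>

lemma prod_list_in_span_rel:
  fixes c :: "nat \<times> word \<Rightarrow> 'k::field"
  assumes "finite Q" and "set is \<subseteq> J"
  shows "prod_list (map (\<lambda>i. \<Sum>w\<in>Q. wscale (c (i, w)) (X w)) is)
    \<in> R.span (rel Q is ` {M. set_mset M \<subseteq> J \<times> Q \<and> size M = length is})"
proof -
  let ?L = "word_lists Q (length is)" and ?\<mu> = "\<lambda>ws. mset (zip is ws)"
  have fin: "finite ?L" using assms(1) by (rule finite_word_lists)
  have "prod_list (map (\<lambda>i. \<Sum>w\<in>Q. wscale (c (i, w)) (X w)) is)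
    = (\<Sum>ws \<in> ?L. wscale (prod_list (map c (zip is ws))) (X (sum_list ws)))"
    by (rule prod_list_expand) fact
  also have "\<dots> = (\<Sum>M \<in> ?\<mu> ` ?L. \<Sum>ws | ws \<in> ?L \<and> ?\<mu> ws = M. wscale (prod_list (map c (zip is ws))) (X (sum_list ws)))"
    by (rule sum.image_gen[OF fin])
  also have "\<dots> = (\<Sum>M \<in> ?\<mu> ` ?L. wscale (prod_mset (image_mset c M)) (rel Q is M))"
    unfolding rel_def R.scale_sum_right
    by (intro sum.cong) (auto simp flip: prod_mset_prod_list)
  also have "\<dots> \<in> R.span (rel Q is ` {M. set_mset M \<subseteq> J \<times> Q \<and> size M = length is})"
  proof (intro R.span_sum R.span_scale R.span_base imageI CollectI)
    fix M
    assume "M \<in> ?\<mu> ` ?L"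
    then obtain ws where ws: "M = ?\<mu> ws" "set ws \<subseteq> Q" "length ws = length is"
      by (auto simp: word_lists_def)
    then show "set_mset M \<subseteq> J \<times> Q \<and> size M = length is"
      using assms(2) by (auto dest: set_zip_leftD set_zip_rightD)
  qed
  finally show ?thesis .
qed

section \<open>Existence of sparse relations that force nilpotence\<close>

definition augmentation :: "nat \<Rightarrow> 'k::field walg set" where
  "augmentation m = R.span (X ` (\<Union>n\<in>{1..}. words m n))"

lemma augmentation_short_words:
  fixes r :: "nat \<Rightarrow> 'k::field walg"
  assumes "\<And>i. i < d \<Longrightarrow> r i \<in> augmentation m"
  shows "\<exists>n. \<forall>i<d. Poly_Mapping.keys (r i) \<subseteq> short_words m n"
proof -
  define K where "K = (\<Union>i<d. Poly_Mapping.keys (r i))"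
  \<comment> \<open>Finitely many elements involve finitely many words, so their lengths are
    bounded; \<open>insert 0\<close> covers the case of no words.\<close>
  define n where "n = Max (insert 0 ((\<lambda>w. length (letters w)) ` K))"
  have "finite K" by (simp add: K_def)
  have "w \<in> short_words m n" if wK: "w \<in> K" for w
  proof -
    obtain i where "i < d" "w \<in> Poly_Mapping.keys (r i)"
      using wK by (auto simp: K_def)
    then obtain l where "1 \<le> l" "w \<in> words m l"
      using assms[of i] by (auto simp: augmentation_def in_span_X_iff)
    moreover from this have "l \<le> n"
      using \<open>finite K\<close> wK by (auto simp: n_def words_def intro!: Max_ge)
    ultimately show ?thesis by (auto simp: short_words_def)
  qed
  then show ?thesis
    by (intro exI[of _ n]) (auto simp: K_def)
qed

lemma sum_UN_le_sum:
  fixes g :: "'a \<Rightarrow> real" and d :: nat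
  assumes "\<And>n. finite (A n)" and "\<And>x. 0 \<le> g x"
  shows "sum g (\<Union>n<d. A n) \<le> (\<Sum>n<d. sum g (A n))"
proof (induction d)
  case 0
  then show ?case by simp
next
  case (Suc d)
  have "sum g (\<Union>n<Suc d. A n) \<le> sum g (\<Union>n<d. A n) + sum g (A d)"
    using assms sum.union_inter[of "\<Union>n<d. A n" "A d" g] sum_nonneg[of "(\<Union>n<d. A n) \<inter> A d" g]
    by (simp add: lessThan_Suc Un_commute)
  then show ?case using Suc by simp
qed

text \<open>Layer \<open>n\<close> deals with elements supported on words of length at most
  \<open>n\<close>. Its length \<open>N n\<close> is chosen so large that its weight is at most
  2^(-n-2); these bounds add up to less than 1/2 = m - \<beta>.\<close>

theorem golod_relations_exist:
  assumes "2 \<le> m"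
  obtains \<Gamma> :: "(nat \<times> 'k::field walg) set"
  where "golod_shafarevich m \<Gamma> (m - 1 / 2)"
    and "\<And>r :: nat \<Rightarrow> 'k walg. (\<And>i. i < m - 1 \<Longrightarrow> r i \<in> augmentation m) \<Longrightarrow>
      \<exists>N\<ge>1. \<forall>is. set is \<subseteq> {..<m - 1} \<and> length is = N \<longrightarrow> prod_list (map r is) \<in> two_sided_ideal \<Gamma>"
proof -
  \<comment> \<open>Any value strictly between m - 1 and m serves: above m - 1 the weight of a layer
    decays, and below m there is room for the relations.\<close>
  define \<beta> :: real where "\<beta> = m - 1 / 2"
  define q where "q n = (m - 1) * card (short_words m n)" for n
  have \<beta>: "1 < \<beta>" using assms by (simp add: \<beta>_def)
  \<comment> \<open>\<open>Suc n \<le> N\<close> puts layer \<open>n\<close> in degrees above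
    \<open>n\<close>, so finitely many layers reach any given degree. The division by
    \<open>\<beta>\<close> makes up for the exponent \<open>N - 1\<close> in the weights.\<close>
  have "\<exists>N\<ge>Suc n. ((m - 1) / \<beta>) ^ N * (N + 1) ^ q n \<le> (1 / 2) ^ (n + 2) / \<beta>" for n
    by (rule exponential_beats_polynomial)
      (use assms \<beta> in \<open>auto simp: \<beta>_def of_nat_diff\<close>)
  then obtain N where N: "\<And>n. Suc n \<le> N n"
    and N_bound: "\<And>n. ((m - 1) / \<beta>) ^ N n * (N n + 1) ^ q n \<le> (1 / 2) ^ (n + 2) / \<beta>"
    by metis
  define \<Gamma> :: "(nat \<times> 'k walg) set" where "\<Gamma> = (\<Union>n. golod_rels m n (N n))"
  let ?w = "\<lambda>(j, f :: 'k walg). (1 / \<beta>) ^ (j - 1)"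
  have layer: "sum ?w (golod_rels m n (N n) :: (nat \<times> 'k walg) set) \<le> (1 / 2) ^ (n + 2)" for n
  proof -
    have "sum ?w (golod_rels m n (N n) :: (nat \<times> 'k walg) set)
        \<le> card (golod_rels m n (N n) :: (nat \<times> 'k walg) set) * (1 / \<beta>) ^ (N n - 1)"
    proof (rule sum_bounded_above, clarify)
      fix j and f :: "'k walg"
      assume "(j, f) \<in> golod_rels m n (N n)"
      then have "N n - 1 \<le> j - 1" using golod_rels_degree by (intro diff_le_mono)
      then show "(1 / \<beta>) ^ (j - 1) \<le> (1 / \<beta>) ^ (N n - 1)"
        using \<beta> by (intro power_decreasing) auto
    qed
    also have "\<dots> \<le> real ((m - 1) ^ N n * (N n + 1) ^ q n) * (1 / \<beta>) ^ (N n - 1)"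
      using golod_rels_bound(2)[of m n "N n", folded q_def] \<beta>
      by (intro mult_right_mono of_nat_mono) auto
    also have "\<dots> = \<beta> * (((m - 1) / \<beta>) ^ N n * (N n + 1) ^ q n)"
    proof -
      obtain N' where "N n = Suc N'" using N[of n] by (cases "N n") auto
      then show ?thesis using \<beta> by (simp add: field_simps)
    qed
    also have "\<dots> \<le> (1 / 2) ^ (n + 2)"
      using N_bound[of n] \<beta> by (simp add: field_simps)
    finally show ?thesis .
  qed
  have below: "{(j, f) \<in> \<Gamma>. j \<le> d} \<subseteq> (\<Union>n<d. golod_rels m n (N n))" for d
  proof clarify
    fix j f
    assume "(j, f) \<in> \<Gamma>" "j \<le> d"
    then obtain n where n: "(j, f) \<in> golod_rels m n (N n)" by (auto simp: \<Gamma>_def)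
    have "n < d" using golod_rels_degree[OF n] N[of n] \<open>j \<le> d\<close> by simp
    then show "(j, f) \<in> (\<Union>n<d. golod_rels m n (N n))" using n by blast
  qed
  show thesis
  proof (rule that)
    have "golod_shafarevich m \<Gamma> \<beta>"
    proof
      fix j f
      assume "(j, f) \<in> \<Gamma>"
      then obtain n where n: "(j, f) \<in> golod_rels m n (N n)" by (auto simp: \<Gamma>_def)
      show "1 \<le> j" using golod_rels_degree[OF n] N[of n] by simp
      show "f \<in> hom m j" using n by (rule golod_rels_homogeneous)
    next
      fix d
      have fin: "finite (\<Union>n<d. golod_rels m n (N n) :: (nat \<times> 'k walg) set)"
        by (simp add: golod_rels_bound(1))
      show "finite {(j, f) \<in> \<Gamma>. j \<le> d}"
        by (rule finite_subset[OF below fin])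
      have "sum ?w {(j, f) \<in> \<Gamma>. j \<le> d} \<le> sum ?w (\<Union>n<d. golod_rels m n (N n))"
        using \<beta> by (intro sum_mono2[OF fin below]) auto
      also have "\<dots> \<le> (\<Sum>n<d. sum ?w (golod_rels m n (N n) :: (nat \<times> 'k walg) set))"
        using \<beta> by (intro sum_UN_le_sum golod_rels_bound(1)) auto
      also have "\<dots> \<le> (\<Sum>n<d. (1 / 2) ^ (n + 2))"
        by (intro sum_mono layer)
      also have "\<dots> = 1 / 2 - (1 / 2) ^ (d + 1)"
        by (induction d) (simp_all add: field_simps)
      also have "\<dots> \<le> m - \<beta>" by (simp add: \<beta>_def)
      finally show "(\<Sum>(j, f) \<in> {(j, f) \<in> \<Gamma>. j \<le> d}. (1 / \<beta>) ^ (j - 1)) \<le> m - \<beta>" .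
    qed (use \<beta> in simp)
    then show "golod_shafarevich m \<Gamma> (m - 1 / 2)" by (simp add: \<beta>_def)
  next
    fix r :: "nat \<Rightarrow> 'k walg"
    assume "\<And>i. i < m - 1 \<Longrightarrow> r i \<in> augmentation m"
    then obtain n where keys: "\<And>i. i < m - 1 \<Longrightarrow> Poly_Mapping.keys (r i) \<subseteq> short_words m n"
      using augmentation_short_words[of "m - 1" r m] by blast
    let ?Q = "short_words m n"
    \<comment> \<open>Padded with zero coefficients, each \<open>r i\<close> is a specialization of
      a generic element on the common support \<open>?Q\<close>.\<close>
    have r: "r i = (\<Sum>w\<in>?Q. wscale (Poly_Mapping.lookup (r i) w) (X w))" if "i < m - 1" for i
    proof -
      have "r i = (\<Sum>w\<in>Poly_Mapping.keys (r i). wscale (Poly_Mapping.lookup (r i) w) (X w))"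
        by (rule walg_eq_sum)
      also have "\<dots> = (\<Sum>w\<in>?Q. wscale (Poly_Mapping.lookup (r i) w) (X w))"
        using keys[OF that] by (intro sum.mono_neutral_left finite_short_words) (auto simp: in_keys_iff)
      finally show ?thesis .
    qed
    have "prod_list (map r is) \<in> two_sided_ideal \<Gamma>"
      if "is": "set is \<subseteq> {..<m - 1}" "length is = N n" for "is"
    proof -
      have eq: "map r is = map (\<lambda>i. \<Sum>w\<in>?Q. wscale (Poly_Mapping.lookup (r i) w) (X w)) is"
        using r "is"(1) by (intro map_cong) auto
      have "prod_list (map r is) \<in> R.span (rel ?Q is ` {M. set_mset M \<subseteq> {..<m - 1} \<times> ?Q \<and> size M = length is})"
        unfolding eq using prod_list_in_span_rel[OF finite_short_words "is"(1), of "\<lambda>(i, w). Poly_Mapping.lookup (r i) w"] by simp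
      also have "\<dots> \<subseteq> two_sided_ideal \<Gamma>"
      proof (rule R.span_minimal[OF _ subspace_ideal], clarify)
        fix M
        assume "set_mset M \<subseteq> {..<m - 1} \<times> ?Q" "size M = length is"
        then have "(rel_degree M, rel ?Q is M) \<in> golod_rels m n (N n)"
          unfolding golod_rels_def using "is" by (intro image_eqI[of _ _ "(is, M)"]) auto
        then show "rel ?Q is M \<in> two_sided_ideal \<Gamma>"
          by (intro relation_in_ideal) (auto simp: \<Gamma>_def)
      qed
      finally show ?thesis .
    qed
    moreover have "1 \<le> N n" using N[of n] by simp
    ultimately show "\<exists>N\<ge>1. \<forall>is. set is \<subseteq> {..<m - 1} \<and> length is = N \<longrightarrow> prod_list (map r is) \<in> two_sided_ideal \<Gamma>"
      by blast
  qed
qed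

section \<open>Derivations of the polynomial algebra\<close>

definition var :: "nat \<Rightarrow> 'k::field poly_inf" where
  "var i = Poly_Mapping.single (Poly_Mapping.single i 1) 1"

interpretation B: vector_space poly_scale
  by (rule vector_space_poly_scale)

text \<open>Reduces both the uniqueness of derivations and local nilpotence to the
  variables.\<close>

lemma poly_inf_induct [case_names const var add mult]:
  fixes p :: "'k::field poly_inf"
  assumes const: "\<And>c. P (Poly_Mapping.single 0 c)" and var: "\<And>i. P (var i)"
    and add: "\<And>p q. P p \<Longrightarrow> P q \<Longrightarrow> P (p + q)" and mult: "\<And>p q. P p \<Longrightarrow> P q \<Longrightarrow> P (p * q)"
  shows "P p"
proof (induction p rule: poly_mapping_single_induct)
  case zero
  show ?case using const[of 0] by simp
next
  case (single e c)
  have one: "P 1" using const[of 1] by simp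
  have "P (Poly_Mapping.single e 1)"
  proof (induction e rule: poly_mapping_single_induct)
    case zero
    show ?case using one by simp
  next
    case (single i n)
    show ?case
    proof (induction n)
      case 0
      then show ?case using one by simp
    next
      case (Suc n)
      have "Poly_Mapping.single (Poly_Mapping.single i (Suc n)) 1 = var i * Poly_Mapping.single (Poly_Mapping.single i n) (1 :: 'k)"
        by (simp add: var_def mult_single flip: single_add)
      then show ?case using mult[OF var Suc] by metis
    qed
  next
    case (add e f)
    then show ?case using mult[OF add] by (simp add: mult_single)
  qed
  then show ?case using mult[OF const[of c]] by (fastforce simp: mult_single)
next
  case (add p q)
  then show ?case by (rule assms(3))
qed

text \<open>The index type is left open because the extension is made from monomials in
  \<open>derivation\<close> and from words in \<open>embed\<close>.\<close>

definition linear_ext :: "('a \<Rightarrow> 'k::field poly_inf) \<Rightarrow> ('a \<Rightarrow>\<^sub>0 'k) \<Rightarrow> 'k poly_inf" where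
  "linear_ext g p = (\<Sum>a\<in>Poly_Mapping.keys p. poly_scale (Poly_Mapping.lookup p a) (g a))"

lemma linear_ext_superset:
  assumes "finite K" "Poly_Mapping.keys p \<subseteq> K"
  shows "linear_ext g p = (\<Sum>a\<in>K. poly_scale (Poly_Mapping.lookup p a) (g a))"
  unfolding linear_ext_def using assms
  by (intro sum.mono_neutral_left) (auto simp: in_keys_iff)

lemma linear_ext_zero [simp]: "linear_ext g 0 = 0"
  by (simp add: linear_ext_def)

lemma linear_ext_single: "linear_ext g (Poly_Mapping.single a c) = poly_scale c (g a)"
  by (subst linear_ext_superset[of "{a}"]) simp_all

lemma linear_ext_add: "linear_ext g (p + q) = linear_ext g p + linear_ext g q"
proof -
  let ?K = "Poly_Mapping.keys p \<union> Poly_Mapping.keys q"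
  have "finite ?K" "Poly_Mapping.keys (p + q) \<subseteq> ?K"
    by (simp_all add: keys_add)
  then show ?thesis
    by (simp add: linear_ext_superset[of ?K] lookup_add B.scale_left_distrib sum.distrib)
qed

lemma poly_scale_mult: "poly_scale c p * q = poly_scale c (p * q)" "p * poly_scale c q = poly_scale c (p * q)"
  by (simp_all add: poly_scale_def mult_ac)

lemma poly_scale_single: "poly_scale c (Poly_Mapping.single e d) = Poly_Mapping.single e (c * d)"
  by (simp add: poly_scale_def mult_single)

lemma linear_ext_poly_scale: "linear_ext g (poly_scale c p) = poly_scale c (linear_ext g p)"
  by (induction p rule: poly_mapping_single_induct)
    (simp_all add: poly_scale_single linear_ext_single linear_ext_add B.scale_right_distrib)

text \<open>The sum of the partial derivatives of the monomial with exponent \<open>e\<close>,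
  multiplied by \<open>t i\<close>: the value forced by the Leibniz rule when the variable
  \<open>i\<close> is sent to \<open>t i\<close>.\<close>

definition monomial_deriv :: "(nat \<Rightarrow> 'k::field poly_inf) \<Rightarrow> (nat \<Rightarrow>\<^sub>0 nat) \<Rightarrow> 'k poly_inf" where
  "monomial_deriv t e = (\<Sum>i\<in>Poly_Mapping.keys e.
     Poly_Mapping.single (e - Poly_Mapping.single i 1) (of_nat (Poly_Mapping.lookup e i)) * t i)"

definition derivation :: "(nat \<Rightarrow> 'k::field poly_inf) \<Rightarrow> 'k poly_inf \<Rightarrow> 'k poly_inf" where
  "derivation t = linear_ext (monomial_deriv t)"

lemma monomial_deriv_superset:
  assumes "finite K" "Poly_Mapping.keys e \<subseteq> K"
  shows "monomial_deriv t e = (\<Sum>i\<in>K.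
     Poly_Mapping.single (e - Poly_Mapping.single i 1) (of_nat (Poly_Mapping.lookup e i)) * t i)"
  unfolding monomial_deriv_def using assms
  by (intro sum.mono_neutral_left) (auto simp: in_keys_iff)

lemma minus_single_add:
  fixes e f :: "nat \<Rightarrow>\<^sub>0 nat"
  assumes "Poly_Mapping.lookup e i \<noteq> 0"
  shows "e + f - Poly_Mapping.single i 1 = e - Poly_Mapping.single i 1 + f"
  using assms by (intro poly_mapping_eqI) (auto simp: lookup_add lookup_minus lookup_single when_def)

text \<open>The Leibniz rule on monomials, checked for each variable. Where its exponent is 0,
  subtraction is truncated, but the coefficient vanishes.\<close>

lemma monomial_deriv_add:
  "monomial_deriv t (e + f) = monomial_deriv t e * Poly_Mapping.single f 1 + Poly_Mapping.single e 1 * monomial_deriv t f"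
proof -
  let ?K = "Poly_Mapping.keys e \<union> Poly_Mapping.keys f"
  let ?m = "\<lambda>e i. Poly_Mapping.single (e - Poly_Mapping.single i 1) (of_nat (Poly_Mapping.lookup e i)) :: 'a poly_inf"
  have K: "finite ?K" "Poly_Mapping.keys (e + f) \<subseteq> ?K"
    by (simp_all add: keys_add)
  have eq: "?m (e + f) i = ?m e i * Poly_Mapping.single f 1 + Poly_Mapping.single e 1 * ?m f i" for i
  proof -
    have "?m e i * Poly_Mapping.single f 1 = Poly_Mapping.single (e + f - Poly_Mapping.single i 1) (of_nat (Poly_Mapping.lookup e i))"
      by (cases "Poly_Mapping.lookup e i = 0") (simp_all add: mult_single minus_single_add del: One_nat_def)
    moreover have "Poly_Mapping.single e 1 * ?m f i = Poly_Mapping.single (e + f - Poly_Mapping.single i 1) (of_nat (Poly_Mapping.lookup f i))"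
      using minus_single_add[of f i e]
      by (cases "Poly_Mapping.lookup f i = 0") (simp_all add: mult_single add.commute del: One_nat_def)
    ultimately show ?thesis by (simp add: lookup_add single_add)
  qed
  have "monomial_deriv t (e + f) = (\<Sum>i\<in>?K. ?m (e + f) i * t i)"
    by (rule monomial_deriv_superset[OF K])
  also have "\<dots> = (\<Sum>i\<in>?K. ?m e i * t i) * Poly_Mapping.single f 1 + Poly_Mapping.single e 1 * (\<Sum>i\<in>?K. ?m f i * t i)"
    unfolding eq by (simp add: sum_distrib_left sum_distrib_right algebra_simps sum.distrib)
  also have "\<dots> = monomial_deriv t e * Poly_Mapping.single f 1 + Poly_Mapping.single e 1 * monomial_deriv t f"
    by (simp add: monomial_deriv_superset[of ?K])
  finally show ?thesis .
qed

lemma derivation_mult: "derivation t (p * q) = derivation t p * q + p * derivation t q"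
proof (induction p rule: poly_mapping_single_induct)
  case zero
  then show ?case by (simp add: derivation_def)
next
  case (single e c)
  show ?case
  proof (induction q rule: poly_mapping_single_induct)
    case zero
    then show ?case by (simp add: derivation_def)
  next
    case (single f d)
    have c: "Poly_Mapping.single e c = poly_scale c (Poly_Mapping.single e 1)"
      "Poly_Mapping.single f d = poly_scale d (Poly_Mapping.single f 1)"
      by (simp_all add: poly_scale_single)
    have "derivation t (Poly_Mapping.single e c * Poly_Mapping.single f d) = poly_scale (c * d) (monomial_deriv t (e + f))"
      by (simp add: derivation_def mult_single linear_ext_single)
    also have "\<dots> = derivation t (Poly_Mapping.single e c) * Poly_Mapping.single f d
        + Poly_Mapping.single e c * derivation t (Poly_Mapping.single f d)"
      unfolding derivation_def linear_ext_single monomial_deriv_add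
      by (subst c(1), subst c(2)) (simp add: poly_scale_mult B.scale_right_distrib mult.commute)
    finally show ?case .
  next
    case (add p q)
    then show ?case
      unfolding derivation_def by (simp add: linear_ext_add algebra_simps)
  qed
next
  case (add p q)
  then show ?case
    unfolding derivation_def by (simp add: linear_ext_add algebra_simps)
qed

lemma derivation_in_Der: "derivation t \<in> Der"
  unfolding Der_def
  using derivation_mult
  by (auto simp: Vector_Spaces.linear_iff vector_space_poly_scale derivation_def linear_ext_add linear_ext_poly_scale)

lemma derivation_var: "derivation t (var i) = t i"
  by (simp add: derivation_def var_def linear_ext_single monomial_deriv_def)

section \<open>Uniqueness of derivations and uniform nilpotence\<close>

lemma DerD:
  assumes "D \<in> Der"
  shows "D 0 = 0" "D (p + q) = D p + D q" "D (poly_scale c p) = poly_scale c (D p)"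
    "D (p * q) = D p * q + p * D q" "D (Poly_Mapping.single 0 c) = 0"
proof -
  interpret Vector_Spaces.linear poly_scale poly_scale D
    using assms by (simp add: Der_def)
  show "D 0 = 0" "D (p + q) = D p + D q" "D (poly_scale c p) = poly_scale c (D p)"
    by (simp_all add: zero add scale)
  show mult: "D (p * q) = D p * q + p * D q" for p q
    using assms by (simp add: Der_def)
  have "D 1 = D 1 + D 1" using mult[of 1 1] by (simp only: mult_1_left mult_1_right)
  then have "D 1 = 0" by (metis add_cancel_right_right)
  then show "D (Poly_Mapping.single 0 c) = 0"
    using scale[of c 1] by (simp add: poly_scale_def)
qed

lemma Der_eqI:
  assumes "D \<in> Der" "E \<in> Der" "\<And>i. D (var i) = E (var i)"
  shows "D = E"
proof
  fix p
  show "D p = E p"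
    by (induction p rule: poly_inf_induct) (simp_all add: DerD assms)
qed

lemma Der_zero: "0 \<in> Der"
proof -
  interpret d: vector_space der_scale by (rule vector_space_der_scale)
  show ?thesis using d.subspace_0[OF subspace_Der] .
qed

text \<open>A uniform form of local nilpotence at \<open>p\<close>: one length \<open>n\<close>
  serves all sequences from \<open>\<Delta>\<close>. This uniformity allows passage to sums and
  products.\<close>

primrec annihilates :: "('b::zero \<Rightarrow> 'b) set \<Rightarrow> nat \<Rightarrow> 'b \<Rightarrow> bool" where
  "annihilates \<Delta> 0 p \<longleftrightarrow> p = 0"
| "annihilates \<Delta> (Suc n) p \<longleftrightarrow> (\<forall>D\<in>\<Delta>. annihilates \<Delta> n (D p))"

context
  fixes \<Delta> :: "('k::field poly_inf \<Rightarrow> 'k poly_inf) set"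
  assumes \<Delta>: "\<Delta> \<subseteq> Der"
begin

lemma annihilates_zero: "annihilates \<Delta> n 0"
  by (induction n) (use \<Delta> DerD(1) in force)+

lemma annihilates_Suc: "annihilates \<Delta> n p \<Longrightarrow> annihilates \<Delta> (Suc n) p"
proof (induction n arbitrary: p)
  case 0
  then show ?case using annihilates_zero[of 1] by simp
qed simp

lemma annihilates_mono: "annihilates \<Delta> n p \<Longrightarrow> n \<le> k \<Longrightarrow> annihilates \<Delta> k p"
  by (induction k) (auto simp: le_Suc_eq intro: annihilates_Suc simp del: annihilates.simps(2))

lemma annihilates_add: "annihilates \<Delta> n p \<Longrightarrow> annihilates \<Delta> n q \<Longrightarrow> annihilates \<Delta> n (p + q)"
proof (induction n arbitrary: p q)
  case (Suc n)
  show ?case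
  proof (simp, intro ballI)
    fix D assume "D \<in> \<Delta>"
    then have "D \<in> Der" using \<Delta> by blast
    then show "annihilates \<Delta> n (D (p + q))"
      using Suc \<open>D \<in> \<Delta>\<close> by (simp add: DerD(2))
  qed
qed simp

text \<open>Each application of the Leibniz rule lowers the index of one of the two factors, until a
  factor reaches index 0 and vanishes.\<close>

lemma annihilates_mult: "annihilates \<Delta> a p \<Longrightarrow> annihilates \<Delta> b q \<Longrightarrow> annihilates \<Delta> (a + b) (p * q)"
proof (induction "a + b" arbitrary: a b p q)
  case 0
  then show ?case by simp
next
  case (Suc n)
  show ?case
  proof (cases "a = 0 \<or> b = 0")
    case True
    then have "p = 0 \<or> q = 0" using Suc.prems by auto
    then show ?thesis using annihilates_zero by auto
  next
    case False
    then obtain a' b' where ab: "a = Suc a'" "b = Suc b'" by (metis not0_implies_Suc)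
    have "annihilates \<Delta> (a' + Suc b') (D (p * q))" if D: "D \<in> \<Delta>" for D
    proof -
      have "annihilates \<Delta> (a' + Suc b') (D p * q)"
        using Suc.prems D ab Suc.hyps(2) by (intro Suc.hyps(1)) auto
      moreover have "annihilates \<Delta> (Suc a' + b') (p * D q)"
        using Suc.prems D ab Suc.hyps(2) by (intro Suc.hyps(1)) auto
      ultimately show ?thesis
        using annihilates_add \<Delta> D by (auto simp: DerD(4) subset_iff simp del: annihilates.simps(2))
    qed
    then show ?thesis by (simp add: ab)
  qed
qed

lemma locally_nilpotent_setI:
  assumes "\<And>i. \<exists>n. annihilates \<Delta> n (var i)"
  shows "locally_nilpotent_set \<Delta>"
  unfolding locally_nilpotent_set_def
proof (intro allI impI)
  fix p and F :: "nat \<Rightarrow> 'k poly_inf \<Rightarrow> 'k poly_inf"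
  assume F: "\<forall>i. F i \<in> \<Delta>"
  have "\<exists>n. annihilates \<Delta> n p"
  proof (induction p rule: poly_inf_induct)
    case (const c)
    have "annihilates \<Delta> 1 (Poly_Mapping.single 0 c)"
      using \<Delta> DerD(5) by auto
    then show ?case ..
  next
    case (var i)
    then show ?case by (rule assms)
  next
    case (add p q)
    then obtain a b where "annihilates \<Delta> a p" "annihilates \<Delta> b q" by blast
    then have "annihilates \<Delta> (max a b) (p + q)"
      by (intro annihilates_add) (auto elim: annihilates_mono)
    then show ?case ..
  next
    case (mult p q)
    then show ?case using annihilates_mult by blast
  qed
  \<comment> \<open>\<open>comp_seq F n\<close> has \<open>n + 1\<close> factors, hence the index
    \<open>Suc n\<close>.\<close>
  then obtain n where n: "annihilates \<Delta> (Suc n) p"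
    using annihilates_Suc by blast
  have "annihilates \<Delta> (n - k) (comp_seq F k p)" if "k \<le> n" for k
    using that
  proof (induction k)
    case 0
    then show ?case using n F by simp
  next
    case (Suc k)
    then have "annihilates \<Delta> (Suc (n - Suc k)) (comp_seq F k p)"
      by (simp add: Suc_diff_Suc del: annihilates.simps(2))
    then show ?case using F by simp
  qed
  from this[of n] show "\<exists>n. comp_seq F n p = 0" by auto
qed

end

section \<open>The action of the quotient algebra\<close>

text \<open>A basis \<open>A\<close> of \<open>I\<close> is extended to a basis \<open>C\<close> of
  the whole space; \<open>\<pi>\<close> kills \<open>A\<close> and fixes the rest of
  \<open>C\<close>. Its values are representatives of the cosets, so the quotient is realized inside
  the free algebra.\<close>

lemma quotient_projection:
  assumes "R.subspace I"
  obtains \<pi> :: "'k::field walg \<Rightarrow> 'k walg"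
  where "\<And>p q. \<pi> (p + q) = \<pi> p + \<pi> q" and "\<And>c p. \<pi> (wscale c p) = wscale c (\<pi> p)"
    and "\<And>p. p \<in> I \<longleftrightarrow> \<pi> p = 0" and "\<And>p. p - \<pi> p \<in> I"
proof -
  interpret RR: vector_space_pair "wscale :: 'k \<Rightarrow> _" wscale ..
  obtain A where A: "A \<subseteq> I" "R.independent A" "I \<subseteq> R.span A"
    by (rule R.maximal_independent_subset)
  obtain C where C: "A \<subseteq> C" "R.independent C" "UNIV \<subseteq> R.span C"
    by (rule R.maximal_independent_subset_extend[OF subset_UNIV A(2)])
  define \<pi> where "\<pi> = RR.construct C (\<lambda>c. if c \<in> A then 0 else c)"
  have lin: "Vector_Spaces.linear wscale wscale \<pi>"
    unfolding \<pi>_def by (rule RR.linear_construct[OF C(2)])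
  have add: "\<pi> (p + q) = \<pi> p + \<pi> q" and scale: "\<pi> (wscale c p) = wscale c (\<pi> p)" for p q c
    using lin by (auto simp: Vector_Spaces.linear_iff)
  have zero: "\<pi> 0 = 0" using scale[of 0 0] by simp
  have base: "\<pi> c = (if c \<in> A then 0 else c)" if "c \<in> C" for c
    unfolding \<pi>_def using that by (rule RR.construct_basis[OF C(2)])
  have in_I: "p - \<pi> p \<in> I" for p
  proof -
    have "p \<in> R.span C" using C(3) by blast
    then show ?thesis
    proof (induction rule: R.span_induct_alt)
      case base
      then show ?case using assms by (simp add: zero R.subspace_0)
    next
      case (step c x y)
      have "x - \<pi> x \<in> I" using step.hyps base A assms by (auto simp: R.subspace_0)
      moreover have "wscale c x + y - \<pi> (wscale c x + y) = wscale c (x - \<pi> x) + (y - \<pi> y)"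
        by (simp add: add scale R.scale_right_diff_distrib)
      ultimately show ?case using step.IH assms by (metis R.subspace_add R.subspace_scale)
    qed
  qed
  have "\<pi> p = 0" if "p \<in> I" for p
  proof -
    have "p \<in> R.span A" using that A(3) by blast
    then show ?thesis
    proof (induction rule: R.span_induct_alt)
      case base
      show ?case by (rule zero)
    next
      case (step c x y)
      then show ?case using base[of x] C(1) by (auto simp: add scale)
    qed
  qed
  then show thesis
    using that[of \<pi>] add scale in_I by (metis diff_zero)
qed

section \<open>Linear forms as a copy of the free algebra\<close>

lemma wscale_single: "wscale c (Poly_Mapping.single w d) = Poly_Mapping.single w (c * d)"
  by (simp add: wscale_def mult_single)

lemma linear_ext_wscale: "linear_ext g (wscale c p) = poly_scale c (linear_ext g p)"
  by (induction p rule: poly_mapping_single_induct)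
    (simp_all add: linear_ext_single linear_ext_add R.scale_right_distrib B.scale_right_distrib
      wscale_single)

text \<open>\<open>list_encode\<close> is a bijection, so every variable belongs to exactly one
  word.\<close>

definition word_var :: "word \<Rightarrow> 'k::field poly_inf" where
  "word_var w = var (list_encode (letters w))"

definition embed :: "'k::field walg \<Rightarrow> 'k poly_inf" where
  "embed = linear_ext word_var"

lemma embed_add: "embed (p + q) = embed p + embed q"
  by (simp add: embed_def linear_ext_add)

lemma embed_zero [simp]: "embed 0 = 0"
  by (simp add: embed_def)

lemma embed_wscale: "embed (wscale c p) = poly_scale c (embed p)"
  by (simp add: embed_def linear_ext_wscale)

lemma var_eq_embed: "var i = embed (X (Word (list_decode i)))"
  by (simp add: embed_def X_def linear_ext_single word_var_def)

lemma embed_diff: "embed (p - q) = embed p - embed q"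
  using embed_add[of "p - q" q] by simp

lemma lookup_embed_word_var:
  "Poly_Mapping.lookup (embed p) (Poly_Mapping.single (list_encode (letters w)) 1) = Poly_Mapping.lookup p w"
proof (induction p rule: poly_mapping_single_induct)
  case (single v c)
  have "list_encode (letters v) = list_encode (letters w) \<longleftrightarrow> v = w"
    by (metis list_encode_inverse word.expand)
  moreover have "Poly_Mapping.single i (1::nat) = Poly_Mapping.single j 1 \<longleftrightarrow> i = j" for i j :: nat
    by (metis keys_single singleton_inject zero_neq_one)
  ultimately show ?case
    by (simp add: embed_def linear_ext_single word_var_def var_def poly_scale_single lookup_single when_def del: One_nat_def)
qed (simp_all add: embed_add lookup_add)

lemma embed_eq_0_iff: "embed p = 0 \<longleftrightarrow> p = 0"
proof
  assume "embed p = 0"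
  then show "p = 0"
    using lookup_embed_word_var[of p] by (intro poly_mapping_eqI) simp
qed simp

text \<open>
  The linear forms are identified with the free algebra by \<open>embed\<close>. As \<open>\<pi>\<close> reduces modulo the
  ideal \<open>I\<close>, the operators \<open>p \<mapsto> \<pi> (r * p)\<close> compose like the elements \<open>r\<close> of the quotient.
\<close>

locale quotient_action =
  fixes I :: "'k::field walg set" and \<pi> :: "'k walg \<Rightarrow> 'k walg"
  assumes ideal_subspace: "R.subspace I"
    and ideal_left: "q \<in> I \<Longrightarrow> p * q \<in> I"
    and ideal_right: "p \<in> I \<Longrightarrow> p * q \<in> I"
    and \<pi>_add: "\<pi> (p + q) = \<pi> p + \<pi> q"
    and \<pi>_scale: "\<pi> (wscale c p) = wscale c (\<pi> p)"
    and \<pi>_eq_0: "p \<in> I \<longleftrightarrow> \<pi> p = 0"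
    and \<pi>_mod: "p - \<pi> p \<in> I"
begin

text \<open>All linear forms are acted on, reduced or not: one application lands in the range of
  \<open>\<pi>\<close>, and from there on the operators compose as in the quotient.\<close>

definition act :: "'k walg \<Rightarrow> 'k poly_inf \<Rightarrow> 'k poly_inf" where
  "act r = derivation (\<lambda>i. embed (\<pi> (r * X (Word (list_decode i)))))"

lemma act_in_Der: "act r \<in> Der"
  by (simp add: act_def derivation_in_Der)

lemma \<pi>_zero [simp]: "\<pi> 0 = 0"
  using \<pi>_scale[of 0 0] by simp

lemma \<pi>_diff: "\<pi> (p - q) = \<pi> p - \<pi> q"
  using \<pi>_add[of "p - q" q] by simp

lemma \<pi>_mult: "\<pi> (r * \<pi> p) = \<pi> (r * p)"
proof -
  have "\<pi> (r * (p - \<pi> p)) = 0"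
    using ideal_left[OF \<pi>_mod] \<pi>_eq_0 by blast
  then show ?thesis by (simp add: right_diff_distrib \<pi>_diff)
qed

lemma act_embed: "act r (embed p) = embed (\<pi> (r * p))"
proof (induction p rule: poly_mapping_single_induct)
  case zero
  then show ?case by (simp add: DerD(1)[OF act_in_Der])
next
  case (single w c)
  have "embed (X w :: 'k walg) = var (list_encode (letters w))"
    by (simp add: var_eq_embed)
  then have "act r (embed (X w)) = embed (\<pi> (r * X w))"
    by (simp add: act_def derivation_var)
  then show ?case
    by (simp add: single_eq_wscale embed_wscale DerD(3)[OF act_in_Der] wscale_mult_right \<pi>_scale)
next
  case (add p q)
  then show ?case
    by (simp add: embed_add DerD(2)[OF act_in_Der] distrib_left \<pi>_add)
qed

lemma act_eqI:
  assumes "D \<in> Der" and "\<And>w. D (embed (X w)) = embed (\<pi> (r * X w))"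
  shows "D = act r"
  by (rule Der_eqI[OF assms(1) act_in_Der]) (simp add: var_eq_embed assms(2) act_embed)

lemma act_zero: "act 0 = 0"
  by (rule act_eqI[symmetric]) (simp_all add: Der_zero)

lemma act_add: "act r + act s = act (r + s)"
proof (rule act_eqI)
  interpret d: vector_space der_scale by (rule vector_space_der_scale)
  show "act r + act s \<in> Der"
    by (intro d.subspace_add subspace_Der act_in_Der)
qed (simp add: act_embed embed_add distrib_right \<pi>_add)

lemma act_scale: "der_scale c (act r) = act (wscale c r)"
proof (rule act_eqI)
  interpret d: vector_space der_scale by (rule vector_space_der_scale)
  show "der_scale c (act r) \<in> Der"
    by (intro d.subspace_scale subspace_Der act_in_Der)
qed (simp add: der_scale_def act_embed embed_wscale wscale_mult_left \<pi>_scale)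

lemma act_bracket: "lie_bracket (act r) (act s) = act (r * s - s * r)"
  by (rule act_eqI)
    (simp_all add: lie_bracket_in_Der act_in_Der, simp add: lie_bracket_def act_embed \<pi>_mult
      left_diff_distrib \<pi>_diff embed_diff mult.assoc)

lemma act_eq_0:
  assumes "r \<in> I"
  shows "act r = 0"
proof (rule act_eqI[symmetric, OF Der_zero])
  fix w
  have "\<pi> (r * X w) = 0"
    using assms ideal_right \<pi>_eq_0 by blast
  then show "0 (embed (X w)) = embed (\<pi> (r * X w))" by simp
qed

lemma lie_subalgebra_act:
  assumes "R.subspace S" and "\<And>r s. r \<in> S \<Longrightarrow> s \<in> S \<Longrightarrow> r * s \<in> S"
  shows "lie_subalgebra (act ` S)"
proof -
  interpret d: vector_space der_scale by (rule vector_space_der_scale)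
  have "0 \<in> act ` S"
    using R.subspace_0[OF assms(1)] act_zero by (metis image_eqI)
  then have "d.subspace (act ` S)"
    unfolding d.subspace_def
    using assms(1) by (auto simp: act_add act_scale R.subspace_add R.subspace_scale)
  then show ?thesis
    unfolding lie_subalgebra_def
    using assms by (auto simp: act_in_Der act_bracket intro!: imageI R.subspace_diff)
qed

text \<open>For positive \<open>n\<close> this is the \<open>n\<close>-th power of the nonunital
  associative algebra generated by \<open>G\<close>; for \<open>n = 0\<close> the unit is
  included.\<close>

definition products :: "'k walg set \<Rightarrow> nat \<Rightarrow> 'k walg set" where
  "products G n = R.span {prod_list xs |xs. set xs \<subseteq> G \<and> n \<le> length xs}"

lemma products_mult:
  assumes "p \<in> products G a" and "q \<in> products G b"
  shows "p * q \<in> products G (a + b)"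
  using R.subspace_span _ assms[unfolded products_def] unfolding products_def
proof (rule span_mult)
  fix x y
  assume "x \<in> {prod_list xs |xs. set xs \<subseteq> G \<and> a \<le> length xs}"
    "y \<in> {prod_list xs |xs. set xs \<subseteq> G \<and> b \<le> length xs}"
  then obtain xs ys where "x = prod_list xs" "set xs \<subseteq> G" "a \<le> length xs"
    "y = prod_list ys" "set ys \<subseteq> G" "b \<le> length ys" by blast
  then have "x * y = prod_list (xs @ ys)" "set (xs @ ys) \<subseteq> G" "a + b \<le> length (xs @ ys)"
    by simp_all
  then show "x * y \<in> R.span {prod_list xs |xs. set xs \<subseteq> G \<and> a + b \<le> length xs}"
    by (intro R.span_base) blast
qed

lemma products_mono: "a \<le> b \<Longrightarrow> products G b \<subseteq> products G a"
  unfolding products_def by (intro R.span_mono) auto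

lemma products_1: "r \<in> G \<Longrightarrow> r \<in> products G 1"
  unfolding products_def by (intro R.span_base CollectI exI[of _ "[r]"]) simp

lemma subspace_products: "R.subspace (products G n)"
  by (simp add: products_def)

lemma products_subset_ideal:
  assumes "\<And>xs. set xs \<subseteq> G \<Longrightarrow> length xs = N \<Longrightarrow> prod_list xs \<in> I"
  shows "products G N \<subseteq> I"
  unfolding products_def
proof (rule R.span_minimal[OF _ ideal_subspace], safe)
  fix xs
  assume xs: "set xs \<subseteq> G" "N \<le> length xs"
  have "prod_list xs = prod_list (take N xs) * prod_list (drop N xs)"
    by (simp flip: prod_list.append)
  moreover have "prod_list (take N xs) \<in> I"
    using xs by (intro assms) (auto dest: in_set_takeD)
  ultimately show "prod_list xs \<in> I" using ideal_right by simp
qed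

text \<open>The associative algebra generated by \<open>G\<close> is closed under commutators, so it
  accounts for all Lie elements, and their nilpotence is reduced to that of products.\<close>

lemma hull_act_subset_products:
  "lie_subalgebra hull (act ` G) \<subseteq> act ` products G 1"
proof (rule hull_minimal)
  show "act ` G \<subseteq> act ` products G 1" using products_1 by blast
  show "lie_subalgebra (act ` products G 1)"
    using products_mult[of _ G 1 _ 1] products_mono[of 1 2 G]
    by (intro lie_subalgebra_act subspace_products) (auto simp: numeral_2_eq_2)
qed

text \<open>A composite of \<open>n\<close> operators is left multiplication by an element of
  \<open>products G n\<close>; applying one operator replaces \<open>p\<close> by
  \<open>s * p\<close> and lowers \<open>n\<close> by one.\<close>

lemma annihilates_embed:
  assumes "\<Delta> \<subseteq> act ` products G 1" and "\<And>s. s \<in> products G n \<Longrightarrow> s * p \<in> I"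
  shows "annihilates \<Delta> n (embed (\<pi> p))"
  using assms(2)
proof (induction n arbitrary: p)
  case 0
  have "1 \<in> products G 0"
    unfolding products_def by (intro R.span_base CollectI exI[of _ "[]"]) simp
  then have "p \<in> I" using 0 by fastforce
  then show ?case by (simp add: \<pi>_eq_0)
next
  case (Suc n)
  show ?case
  proof (simp, intro ballI)
    fix D assume "D \<in> \<Delta>"
    then obtain s where s: "D = act s" "s \<in> products G 1" using assms(1) by blast
    have "annihilates \<Delta> n (embed (\<pi> (s * p)))"
    proof (rule Suc.IH)
      fix s' assume "s' \<in> products G n"
      then have "s' * s \<in> products G (Suc n)"
        using products_mult[OF _ s(2)] by force
      then show "s' * (s * p) \<in> I"
        using Suc.prems[of "s' * s"] by (simp add: mult.assoc)
    qed
    then show "annihilates \<Delta> n (D (embed (\<pi> p)))"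
      by (simp add: s act_embed \<pi>_mult)
  qed
qed

lemma nilpotent_products:
  assumes "products G N \<subseteq> I" and "\<Delta> \<subseteq> act ` products G 1" and "1 \<le> N"
  shows "locally_nilpotent_set \<Delta>" and "nilpotent_lie \<Delta>"
proof -
  \<comment> \<open>\<open>annihilates_embed\<close> speaks of reduced forms; the first operator
    produces one, hence \<open>Suc N\<close>.\<close>
  have "annihilates \<Delta> (Suc N) (var i)" for i
  proof (simp, intro ballI)
    fix D assume "D \<in> \<Delta>"
    then obtain s where s: "D = act s" "s \<in> products G 1" using assms(2) by blast
    have "annihilates \<Delta> N (embed (\<pi> (s * X (Word (list_decode i)))))"
      using assms(1) ideal_right by (intro annihilates_embed[OF assms(2)]) blast
    then show "annihilates \<Delta> N (D (var i))"
      by (simp add: s var_eq_embed act_embed)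
  qed
  moreover have "\<Delta> \<subseteq> Der" using assms(2) act_in_Der by blast
  ultimately show "locally_nilpotent_set \<Delta>"
    using locally_nilpotent_setI by blast
  have "nested_bracket x (N - 1) = 0" if x: "\<forall>i<N. x i \<in> \<Delta>" for x
  proof -
    have "nested_bracket x k \<in> act ` products G (Suc k)" if "k < N" for k
      using that
    proof (induction k)
      case 0
      then show ?case using x assms(2) by auto
    next
      case (Suc k)
      then obtain r s where r: "x (Suc k) = act r" "r \<in> products G 1"
        and s: "nested_bracket x k = act s" "s \<in> products G (Suc k)"
        using x assms(2) by (auto simp: subset_iff image_iff)
      have "r * s \<in> products G (Suc (Suc k))" "s * r \<in> products G (Suc (Suc k))"
        using products_mult[OF r(2) s(2)] products_mult[OF s(2) r(2)] by simp_all
      then show ?case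
        by (simp add: r s act_bracket) (intro imageI R.subspace_diff subspace_products)
    qed
    from this[of "N - 1"] have "nested_bracket x (N - 1) \<in> act ` products G N"
      using assms(3) by simp
    then show ?thesis using assms(1) act_eq_0 by auto
  qed
  then show "nilpotent_lie \<Delta>"
    unfolding nilpotent_lie_def using assms(3) by blast
qed

section \<open>Nilpotence of the maps ad x\<close>

lemma ad_act_funpow:
  "(lie_bracket (act r) ^^ n) (act s) = act (((\<lambda>s. r * s - s * r) ^^ n) s)"
  by (induction n) (simp_all add: act_bracket)

text \<open>Every application adds a factor \<open>r\<close> on the left or on the right of
  \<open>s\<close>, so in the end one side has at least \<open>N\<close> of them. The exponents
  \<open>i\<close> and \<open>j\<close> are carried along for the induction.\<close>

lemma ad_funpow_in_ideal:
  assumes "r ^ N \<in> I" and "2 * N \<le> n + i + j"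
  shows "((\<lambda>s. r * s - s * r) ^^ n) (r ^ i * s * r ^ j) \<in> I"
  using assms(2)
proof (induction n arbitrary: i j)
  case 0
  then consider "N \<le> i" | "N \<le> j" by linarith
  then have "r ^ i * s * r ^ j \<in> I"
  proof cases
    case 1
    then have "r ^ i = r ^ N * r ^ (i - N)" by (simp flip: power_add)
    then show ?thesis using assms(1) ideal_right by (simp add: mult.assoc)
  next
    case 2
    then have "r ^ j = r ^ (j - N) * r ^ N" by (simp flip: power_add)
    then show ?thesis using assms(1) ideal_left by (simp flip: mult.assoc)
  qed
  then show ?case by simp
next
  case (Suc n)
  let ?ad = "\<lambda>s. r * s - s * r"
  have diff: "(?ad ^^ n) (p - q) = (?ad ^^ n) p - (?ad ^^ n) q" for p q
    by (induction n) (simp_all, simp add: algebra_simps)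
  have "r * (r ^ i * s * r ^ j) = r ^ Suc i * s * r ^ j" "r ^ i * s * r ^ j * r = r ^ i * s * r ^ Suc j"
    by (simp_all add: mult.assoc power_commutes)
  then have "(?ad ^^ Suc n) (r ^ i * s * r ^ j)
      = (?ad ^^ n) (r ^ Suc i * s * r ^ j) - (?ad ^^ n) (r ^ i * s * r ^ Suc j)"
    by (simp only: funpow_Suc_right comp_def diff)
  then show ?case
    using Suc.IH[of "Suc i" j] Suc.IH[of i "Suc j"] Suc.prems ideal_subspace
    by (simp add: R.subspace_diff del: funpow.simps)
qed

lemma nil_lie_act:
  assumes "L \<subseteq> act ` S" and "\<And>r. r \<in> S \<Longrightarrow> \<exists>N. r ^ N \<in> I"
  shows "nil_lie L"
  unfolding nil_lie_def
proof
  fix x assume "x \<in> L"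
  then obtain r where r: "x = act r" "r \<in> S" using assms(1) by blast
  then obtain N where N: "r ^ N \<in> I" using assms(2) by blast
  have "(lie_bracket x ^^ (2 * N)) y = 0" if "y \<in> L" for y
  proof -
    obtain s where s: "y = act s" using \<open>y \<in> L\<close> assms(1) by blast
    have "((\<lambda>s. r * s - s * r) ^^ (2 * N)) s \<in> I"
      using ad_funpow_in_ideal[OF N, of "2 * N" 0 0 s] by simp
    then show ?thesis by (simp add: r s ad_act_funpow act_eq_0)
  qed
  then show "\<exists>n. \<forall>y\<in>L. (lie_bracket x ^^ n) y = 0" by blast
qed

section \<open>An infinite sequence of letters avoiding the ideal\<close>

text \<open>
  Koenig's lemma, applied to the tree of words outside \<open>I\<close> that have left extensions of every
  length outside \<open>I\<close>.
\<close>

lemma not_locally_nilpotent_act: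
  assumes "\<And>n. \<exists>w\<in>words m n. X w \<notin> I"
    and "\<And>a. a < m \<Longrightarrow> act (X (Word [a])) \<in> L"
  shows "\<not> locally_nilpotent_set L"
proof -
  define good where "good w \<longleftrightarrow> (\<forall>n. \<exists>u\<in>words m n. X (u + w) \<notin> I)" for w
  have good_0: "good 0" using assms(1) by (simp add: good_def)
  have good_step: "\<exists>a<m. good (Word [a] + w)" if w: "good w" for w
  proof (rule ccontr)
    assume "\<not> ?thesis"
    then obtain k where k: "\<And>a u. a < m \<Longrightarrow> u \<in> words m (k a) \<Longrightarrow> X (u + (Word [a] + w)) \<in> I"
      unfolding good_def by metis
    \<comment> \<open>Each letter fails at some length; \<open>n\<close> bounds these lengths for
      all of the finitely many letters.\<close>
    define n where "n = Max (insert 0 (k ` {..<m}))"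
    obtain v where v: "v \<in> words m (Suc n)" "X (v + w) \<notin> I"
      using w unfolding good_def by blast
    obtain u a where u: "v = u + Word [a]" "u \<in> words m n" "a < m"
      using words_Suc_obtain[OF v(1)] by metis
    have "k a \<le> n" using u(3) by (simp add: n_def)
    \<comment> \<open>Exactly \<open>k a\<close> letters are kept in front of \<open>a\<close>; the
      ideal absorbs the remaining prefix.\<close>
    define u1 u2 where "u1 = Word (take (n - k a) (letters u))" and "u2 = Word (drop (n - k a) (letters u))"
    have "u = u1 + u2" "u2 \<in> words m (k a)"
      using u(2) \<open>k a \<le> n\<close> by (auto simp: u1_def u2_def words_def plus_word_def dest: in_set_dropD)
    then have "X (v + w) = X u1 * X (u2 + (Word [a] + w))"
      by (simp add: u X_plus mult.assoc)
    then show False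
      using v(2) k[OF u(3) \<open>u2 \<in> _\<close>] ideal_left by metis
  qed
  define next_letter where "next_letter w = (SOME a. a < m \<and> good (Word [a] + w))" for w
  have nl: "next_letter w < m \<and> good (Word [next_letter w] + w)" if "good w" for w
    unfolding next_letter_def by (rule someI_ex) (rule good_step[OF that])
  define W where "W = rec_nat 0 (\<lambda>_ w. Word [next_letter w] + w)"
  have W0: "W 0 = 0" and WSuc: "W (Suc n) = Word [next_letter (W n)] + W n" for n
    by (simp_all add: W_def)
  have goodW: "good (W n)" for n
    by (induction n) (use nl in \<open>simp_all add: W0 WSuc good_0\<close>)
  define F where "F n = act (X (Word [next_letter (W n)]))" for n
  \<comment> \<open>\<open>embed 1\<close> is the variable of the empty word, and each operator puts
    one more letter in front, modulo the ideal.\<close>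
  have comp: "comp_seq F n (embed 1) = embed (\<pi> (X (W (Suc n))))" for n
  proof (induction n)
    case 0
    then show ?case by (simp add: F_def act_embed WSuc X_plus W0 X_zero)
  next
    case (Suc n)
    then show ?case by (simp add: F_def act_embed \<pi>_mult WSuc[of "Suc n"] X_plus del: WSuc)
  qed
  have notin: "X w \<notin> I" if "good w" for w
    using that[unfolded good_def, rule_format, of 0] by (simp add: words_0)
  then have "comp_seq F n (embed 1) \<noteq> 0" for n
    using goodW by (simp add: comp embed_eq_0_iff flip: \<pi>_eq_0)
  moreover have "F n \<in> L" for n
    using nl[OF goodW] assms(2) by (simp add: F_def)
  ultimately show ?thesis
    unfolding locally_nilpotent_set_def by blast
qed

end

section \<open>Construction of the Lie algebra\<close>

lemma augmentation_mult: "p \<in> augmentation m \<Longrightarrow> q \<in> augmentation m \<Longrightarrow> p * q \<in> augmentation m"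
  unfolding augmentation_def
proof (erule (1) span_mult[OF R.subspace_span, rotated], clarify)
  fix u v i j
  assume "u \<in> words m i" "v \<in> words m j" "i \<ge> (1::nat)"
  then have "u + v \<in> (\<Union>n\<in>{1..}. words m n)"
    using words_plus by fastforce
  then show "X u * X v \<in> R.span (X ` (\<Union>n\<in>{1..}. words m n))"
    by (intro R.span_base) (simp add: image_iff flip: X_plus, blast)
qed

theorem mainTheorem2:
  fixes m :: nat
  assumes "2 \<le> m"
  shows "\<exists>L :: ('k::field poly_inf \<Rightarrow> 'k poly_inf) set.
    lie_subalgebra L \<and> lie_generated_by L m \<and>
    \<not> locally_nilpotent_set L \<and>
    (\<forall>M. lie_subalgebra M \<and> M \<subseteq> L \<and> lie_generated_by M (m - 1) \<longrightarrow>
         locally_nilpotent_set M \<and> nilpotent_lie M) \<and>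
    (\<forall>D\<in>L. locally_nilpotent_derivation D) \<and> nil_lie L"
proof -
  obtain \<Gamma> :: "(nat \<times> 'k walg) set" where GS: "golod_shafarevich m \<Gamma> (m - 1 / 2)"
    and golod: "\<And>r :: nat \<Rightarrow> 'k walg. (\<And>i. i < m - 1 \<Longrightarrow> r i \<in> augmentation m) \<Longrightarrow>
      \<exists>N\<ge>1. \<forall>is. set is \<subseteq> {..<m - 1} \<and> length is = N \<longrightarrow> prod_list (map r is) \<in> two_sided_ideal \<Gamma>"
    using golod_relations_exist[OF assms] by blast
  let ?I = "two_sided_ideal \<Gamma>"
  obtain \<pi> :: "'k walg \<Rightarrow> 'k walg" where \<pi>:
    "\<And>p q. \<pi> (p + q) = \<pi> p + \<pi> q" "\<And>c p. \<pi> (wscale c p) = wscale c (\<pi> p)"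
    "\<And>p. p \<in> ?I \<longleftrightarrow> \<pi> p = 0" "\<And>p. p - \<pi> p \<in> ?I"
    using quotient_projection[OF subspace_ideal] by metis
  interpret quotient_action ?I \<pi>
    by (rule quotient_action.intro) (fact \<pi> subspace_ideal ideal_mult_left ideal_mult_right)+
  define gen where "gen a = act (X (Word [a]))" for a
  define L where "L = lie_subalgebra hull (gen ` {..<m})"
  have gen_Der: "gen a \<in> Der" for a by (simp add: gen_def act_in_Der)
  have lieL: "lie_subalgebra L"
    unfolding L_def by (rule lie_subalgebra_hull) (use gen_Der in blast)
  have genL: "gen a \<in> L" if "a < m" for a
    unfolding L_def using hull_subset[of "gen ` {..<m}" lie_subalgebra] that by blast
  have L_aug: "L \<subseteq> act ` augmentation m"
    unfolding L_def
  proof (rule hull_minimal)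
    have "X (Word [a]) \<in> augmentation m" if "a < m" for a
      unfolding augmentation_def using that
      by (intro R.span_base imageI UN_I[of 1]) (auto simp: words_def)
    then show "gen ` {..<m} \<subseteq> act ` augmentation m"
      by (auto simp: gen_def)
    show "lie_subalgebra (act ` augmentation m)"
      by (rule lie_subalgebra_act) (simp_all add: augmentation_mult, simp add: augmentation_def)
  qed
  have sub: "locally_nilpotent_set M \<and> nilpotent_lie M"
    if M: "M \<subseteq> L" "M = lie_subalgebra hull (g ` {..<m - 1})" for M g
  proof -
    \<comment> \<open>The generators of \<open>M\<close> lie in \<open>L\<close> and so come from
      the augmentation ideal, where \<open>golod\<close> applies to them.\<close>
    have "\<forall>i. \<exists>s. i < m - 1 \<longrightarrow> g i = act s \<and> s \<in> augmentation m"
      using M L_aug hull_subset[of "g ` {..<m - 1}" lie_subalgebra] by blast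
    then obtain r where r: "\<And>i. i < m - 1 \<Longrightarrow> g i = act (r i)" "\<And>i. i < m - 1 \<Longrightarrow> r i \<in> augmentation m"
      using choice by metis
    obtain N where N: "1 \<le> N"
      "\<And>is. set is \<subseteq> {..<m - 1} \<Longrightarrow> length is = N \<Longrightarrow> prod_list (map r is) \<in> ?I"
      using golod[of r, OF r(2)] by blast
    let ?G = "r ` {..<m - 1}"
    have "products ?G N \<subseteq> ?I"
    proof (rule products_subset_ideal)
      fix xs
      assume xs: "set xs \<subseteq> ?G" "length xs = N"
      then have "xs \<in> map r ` lists {..<m - 1}"
        unfolding lists_image[symmetric] by (intro in_listsI) auto
      then obtain "is" where "xs = map r is" "set is \<subseteq> {..<m - 1}"
        by auto
      then show "prod_list xs \<in> ?I" using N(2) xs(2) by simp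
    qed
    moreover have "M \<subseteq> act ` products ?G 1"
    proof -
      have "g ` {..<m - 1} = act ` ?G" using r(1) by (simp add: image_image)
      then show ?thesis using hull_act_subset_products M(2) by simp
    qed
    ultimately show ?thesis
      using nilpotent_products N(1) by blast
  qed
  have "locally_nilpotent_derivation D" if D: "D \<in> L" for D
  proof -
    have "D \<in> Der" using D lieL by (auto simp: lie_subalgebra_def)
    have "0 < m - 1" using assms by simp
    \<comment> \<open>\<open>D\<close> repeated \<open>m - 1\<close> times is an admissible family
      of generators, nonempty because \<open>m\<close> is at least 2.\<close>
    have "lie_subalgebra hull ((\<lambda>_. D) ` {..<m - 1}) \<subseteq> L"
      using D lieL by (intro hull_minimal) auto
    then have nilp: "locally_nilpotent_set (lie_subalgebra hull ((\<lambda>_. D) ` {..<m - 1}))"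
      using sub by blast
    have "D \<in> lie_subalgebra hull ((\<lambda>_. D) ` {..<m - 1})"
      using hull_subset[of "(\<lambda>_. D) ` {..<m - 1}" lie_subalgebra] \<open>0 < m - 1\<close> by blast
    then have "\<exists>n. comp_seq (\<lambda>_. D) n p = 0" for p
      using nilp[unfolded locally_nilpotent_set_def, THEN spec, THEN spec, of "\<lambda>_. D" p] by blast
    moreover have "comp_seq (\<lambda>_. D) n = D ^^ Suc n" for n
      by (induction n) simp_all
    ultimately show ?thesis
      unfolding locally_nilpotent_derivation_def using \<open>D \<in> Der\<close> by (metis zero_less_Suc)
  qed
  moreover have "nil_lie L"
  proof (rule nil_lie_act[OF L_aug])
    fix r :: "'k walg" assume "r \<in> augmentation m"
    then obtain N where "\<And>is. set is \<subseteq> {..<m - 1} \<Longrightarrow> length is = N \<Longrightarrow> prod_list (map (\<lambda>_. r) is) \<in> ?I"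
      using golod[of "\<lambda>_. r"] by blast
    \<comment> \<open>For the constant family \<open>r\<close>, the list of \<open>N\<close> indices
      0 yields the power \<open>r ^ N\<close>; index 0 is allowed because
      \<open>0 < m - 1\<close>.\<close>
    from this[of "replicate N 0"] have "r ^ N \<in> ?I"
      using assms by (simp add: prod_list_replicate set_replicate_conv_if)
    then show "\<exists>N. r ^ N \<in> ?I" ..
  qed
  moreover have "\<not> locally_nilpotent_set L"
    by (rule not_locally_nilpotent_act[of m])
      (use golod_shafarevich.ideal_misses_word[OF GS] genL in \<open>auto simp: gen_def\<close>)
  moreover have "lie_generated_by L m"
    unfolding lie_generated_by_def L_def using gen_Der by (intro exI[of _ gen]) simp
  moreover have "locally_nilpotent_set M \<and> nilpotent_lie M" if "M \<subseteq> L" "lie_generated_by M (m - 1)" for M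
    using that sub[of M] unfolding lie_generated_by_def by (elim exE) simp
  ultimately show ?thesis
    using lieL by (intro exI[of _ L]) simp
qed

end
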